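(* Let $k\geq 2$ be an integer, let $\boldsymbol{F}$ be a $(k-1)$-dimensional simplicial complex and let $\mathcal{E}(\boldsymbol{F})$ be the set of maximal edges of $\boldsymbol{F}$. Then $\boldsymbol{F}$ is trivial if one of the following holds: (i) $\mathcal{E}(\boldsymbol{F})=E(\boldsymbol{F}^k)$; (ii) $\mathcal{E}(\boldsymbol{F})$ consists of pairwise disjoint edges; (iii) $|\mathcal{E}(\boldsymbol{F})|\leq 2$; (iv) $k\geq 3$ and $\mathcal{E}(\boldsymbol{F})=\{\{1,2,\dots,k\},\{1,k+1,\dots,2k-2\},\{2,k+1,\dots,2k-2\}\}$ (up to isomorphism). Moreover: (a) if $\boldsymbol{F}$ satisfies (i) and $\boldsymbol{F}^k$ is edge-degenerate or a linear cycle, then $\mathrm{ex}(n,\boldsymbol{F})=\Theta(n^{k-1})$; (b) if $\boldsymbol{F}$ satisfies (ii), then for all sufficiently large $n$, \[\mathrm{ex}(n,\boldsymbol{F})=\sum_{r=1}^{t-1}\sum_{i=1}^{r}\binom{t-1}{r}\binom{n-t+1}{k-i}+\sum_{r=0}^{k-1}\binom{n}{r},\] where $t$ is the number of edges of $\boldsymbol{F}^k$.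
   Context: An (abstract) simplicial complex $\boldsymbol{F}=(V,E)$ is a hypergraph with $E\subseteq 2^V$ containing all singletons and closed under taking subsets (the empty set is also an edge). Its dimension is its maximum edge size minus $1$. $\boldsymbol{F}^r$ denotes the $r$-uniform hypergraph on $V$ of all $r$-element edges of $\boldsymbol{F}$. A simplicial complex is $\boldsymbol{F}$-free if it contains no isomorphic copy of $\boldsymbol{F}$, and $\mathrm{ex}(n,\boldsymbol{F})$ is the maximum number of edges of an $\boldsymbol{F}$-free simplicial complex on $n$ vertices. Given a $k$-uniform hypergraph $G$, a set $T\subseteq V(G)$ is a clique in $G$ if $T$ is a singleton, or $T$ is a subset of some edge of $G$, or every $k$-element subset of $T$ is an edge of $G$. For a $k$-uniform hypergraph $H$, $\mathrm{ex}_k^{c\ell+}(n,H)$ is the maximum number of cliques of order at least $k$ in an $n$-vertex $H$-free $k$-uniform hypergraph. A $(k-1)$-dimensional simplicial complex $\boldsymbol{F}$ is trivial if for all sufficiently large $n$, $\mathrm{ex}(n,\boldsymbol{F})=\mathrm{ex}_k^{c\ell+}(n,\boldsymbol{F}^k)+\sum_{r=0}^{k-1}\binom{n}{r}$. A hypergraph $H$ is edge-degenerate if its edges can be ordered $e_1,\dots,e_m$ such that for every $i\in\{2,\dots,m\}$ there is $j\in\{1,\dots,i-1\}$ with $e_i\cap\bigcup_{r=1}^{i-1}e_r\subseteq e_j$. A $k$-uniform linear cycle of length $s$ consists of $s$ edges cyclically ordered such that consecutive edges share exactly one vertex, non-consecutive edges are disjoint, and every vertex lies in at most two edges.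
   Formalization: In (a), the linear cycle case is stated only for k ≥ 3: for k = 2 it is false, since for the triangle complete bipartite graphs give ex(n,F) ≥ ⌊n²/4⌋, and likewise ex(n,F) is superlinear for every graph cycle of length at least 3. *)

theory Defs
  imports Complex_Main "HOL-Library.Landau_Symbols"
begin

datatype 'a hypergraph = Hypergraph (verts: "'a set") (edges: "'a set set")

definition is_hypergraph :: "'a hypergraph \<Rightarrow> bool" where
  "is_hypergraph H \<longleftrightarrow> finite (verts H) \<and> edges H \<subseteq> Pow (verts H)"

definition uniform_hypergraph :: "nat \<Rightarrow> 'a hypergraph \<Rightarrow> bool" where
  "uniform_hypergraph k H \<longleftrightarrow> is_hypergraph H \<and> (\<forall>e\<in>edges H. card e = k)"

definition simplicial_complex :: "'a hypergraph \<Rightarrow> bool" where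
  "simplicial_complex F \<longleftrightarrow> is_hypergraph F \<and> {} \<in> edges F \<and>
     (\<forall>v\<in>verts F. {v} \<in> edges F) \<and> (\<forall>e\<in>edges F. \<forall>e'. e' \<subseteq> e \<longrightarrow> e' \<in> edges F)"

text \<open>Integer-valued, since the complex whose only edge is the empty set has dimension -1.\<close>
definition complex_dim :: "'a hypergraph \<Rightarrow> int" where
  "complex_dim F = int (Max (card ` edges F)) - 1"

definition uniform_part :: "'a hypergraph \<Rightarrow> nat \<Rightarrow> 'a hypergraph" where
  "uniform_part F r = Hypergraph (verts F) {e \<in> edges F. card e = r}"

definition maximal_edges :: "'a hypergraph \<Rightarrow> 'a set set" where
  "maximal_edges F = {e \<in> edges F. \<forall>e'\<in>edges F. e \<subseteq> e' \<longrightarrow> e' = e}"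

definition isomorphic :: "'a hypergraph \<Rightarrow> 'b hypergraph \<Rightarrow> bool" where
  "isomorphic H H' \<longleftrightarrow>
     (\<exists>f. bij_betw f (verts H) (verts H') \<and> edges H' = (\<lambda>e. f ` e) ` edges H)"

definition subhypergraph :: "'a hypergraph \<Rightarrow> 'a hypergraph \<Rightarrow> bool" where
  "subhypergraph H G \<longleftrightarrow> verts H \<subseteq> verts G \<and> edges H \<subseteq> edges G"

text \<open>Copies are not required to be induced.\<close>
definition free_of :: "'a hypergraph \<Rightarrow> 'b hypergraph \<Rightarrow> bool" where
  "free_of F G \<longleftrightarrow> \<not> (\<exists>F'. subhypergraph F' G \<and> isomorphic F F')"

text \<open>
  The host hypergraphs in the two extremal functions are taken over \<^typ>\<open>nat\<close>, which represents
  every finite hypergraph up to isomorphism. The sets under \<^const>\<open>Max\<close> are finite, and they are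
  nonempty whenever the forbidden hypergraph has an edge with at least two vertices
  (respectively, has an edge). The empty edge is counted by \<open>ex_complex\<close>.
\<close>
definition ex_complex :: "nat \<Rightarrow> 'a hypergraph \<Rightarrow> nat" where
  "ex_complex n F = Max {card (edges G) | G :: nat hypergraph.
     simplicial_complex G \<and> card (verts G) = n \<and> free_of F G}"

definition is_clique :: "nat \<Rightarrow> 'a hypergraph \<Rightarrow> 'a set \<Rightarrow> bool" where
  "is_clique k G T \<longleftrightarrow> T \<subseteq> verts G \<and>
     ((\<exists>v. T = {v}) \<or> (\<exists>e\<in>edges G. T \<subseteq> e) \<or> (\<forall>S. S \<subseteq> T \<and> card S = k \<longrightarrow> S \<in> edges G))"

definition ex_clique_plus :: "nat \<Rightarrow> nat \<Rightarrow> 'a hypergraph \<Rightarrow> nat" where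
  "ex_clique_plus k n H = Max {card {T. is_clique k G T \<and> k \<le> card T} | G :: nat hypergraph.
     uniform_hypergraph k G \<and> card (verts G) = n \<and> free_of H G}"

text \<open>Meaningful for complexes of dimension \<open>k - 1\<close>.\<close>
definition trivial_complex :: "nat \<Rightarrow> 'a hypergraph \<Rightarrow> bool" where
  "trivial_complex k F \<longleftrightarrow>
     (\<forall>\<^sub>F n in sequentially.
        ex_complex n F = ex_clique_plus k n (uniform_part F k) + (\<Sum>r=0..k-1. n choose r))"

definition edge_degenerate :: "'a hypergraph \<Rightarrow> bool" where
  "edge_degenerate H \<longleftrightarrow>
     (\<exists>es. distinct es \<and> set es = edges H \<and>
        (\<forall>i\<in>{1..<length es}. \<exists>j<i. es ! i \<inter> (\<Union>r<i. es ! r) \<subseteq> es ! j))"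

text \<open>
  As usual for cycles, the length is at least 3. The last conjunct matters only for length 3,
  where it excludes three edges through one common vertex.
\<close>
definition linear_cycle :: "nat \<Rightarrow> 'a hypergraph \<Rightarrow> bool" where
  "linear_cycle k H \<longleftrightarrow> uniform_hypergraph k H \<and> verts H = \<Union> (edges H) \<and>
     (\<exists>es. distinct es \<and> set es = edges H \<and> 3 \<le> length es \<and>
        (\<forall>i<length es. \<forall>j<length es. i \<noteq> j \<longrightarrow>
           (if j = Suc i mod length es \<or> i = Suc j mod length es
            then card (es ! i \<inter> es ! j) = 1
            else es ! i \<inter> es ! j = {})) \<and>
        (\<forall>v\<in>verts H. card {e \<in> edges H. v \<in> e} \<le> 2))"

definition config_iv :: "nat \<Rightarrow> nat hypergraph" where
  "config_iv k = Hypergraph {1..2*k-2}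
     {{1..k}, insert 1 {k+1..2*k-2}, insert 2 {k+1..2*k-2}}"

end

theory Submission imports Defs "HOL-Library.Disjoint_Sets" begin

text \<open>
  Write \<open>B n k\<close> for the number of sets of fewer than \<open>k\<close> vertices. Adding these sets to the cliques of
  an extremal \<open>k\<close>-graph always gives an \<open>F\<close>-free complex, so \<open>F\<close> is trivial as soon as every \<open>F\<close>-free
  complex containing a copy of \<open>F\<^sup>k\<close> has at most \<open>B n k\<close> edges. In case (i) there is no such complex. In
  case (ii) all edges of such a complex have fewer than \<open>k - 1\<close> vertices outside a bounded set. In cases
  (iii) and (iv) an edge \<open>D\<close> with at least \<open>k\<close> vertices forbids many \<open>(k - 1)\<close>-sets (those meeting \<open>D\<close> in a
  prescribed way), while intersection conditions on the large edges bound how often one \<open>(k - 1)\<close>-set is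
  forbidden; double counting shows that at least as many \<open>(k - 1)\<close>-sets are missing as there are large edges.

  For (a), delete repeatedly the \<open>k\<close>-edges above a \<open>(k - 1)\<close>-set of bounded degree. A family in which no
  such set is left contains every edge-degenerate hypergraph and every linear cycle, so everything is
  deleted, and each of the \<open>O(n\<^sup>k\<^sup>-\<^sup>1)\<close> steps destroys boundedly many cliques. For (b), the vertices on \<open>k\<close>-edges
  avoiding any prescribed bounded set number at most \<open>t - 1\<close>, and up to \<open>O(n\<^sup>k\<^sup>-\<^sup>2)\<close> edges every edge has
  fewer than \<open>k\<close> vertices outside them.
\<close>

subsection \<open>Copies and maximal edges\<close>

text \<open>In case (iii), with i the number of vertices common to the two maximal edges, a large
  edge forbids order n^(k-1-i) sets, while one set is forbidden by only O(n^(k-2-i)) large edges, so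
  constants do not matter. In case (iv) both counts have order n^(k-2) and leading coefficients
  decide: the bound for the degree of a pair is n choose (k-3) plus lower order terms, and it turns
  into a bound for the degree of a vertex that is asymptotically (k-2)/(k-1) times n choose (k-2).
  This narrow margin is why the large edges through a pair have to be counted so precisely.

  In (a) the difficulty is the linear cycle. It closes up, so it cannot be built edge by edge like
  an edge-degenerate hypergraph; the shared vertices have to be placed beforehand. Uniformity at
  least 3 is essential there: a family of pairs without sparse vertices may be bipartite and then
  has no odd cycle.

  In (b), having fewer than t-1 rich vertices costs order n^(k-1) sets, more than the exceptional
  edges can give back.\<close>

definition embeds :: "'a hypergraph \<Rightarrow> 'b hypergraph \<Rightarrow> bool" where
  "embeds F G \<longleftrightarrow> (\<exists>\<phi>. inj_on \<phi> (verts F) \<and> \<phi> ` verts F \<subseteq> verts G \<and> (\<forall>e\<in>edges F. \<phi> ` e \<in> edges G))"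

lemma free_of_iff: "free_of F G \<longleftrightarrow> \<not> embeds F G"
proof -
  have "embeds F G" if sub: "subhypergraph F' G" and iso: "isomorphic F F'" for F'
  proof -
    from iso obtain f where f: "bij_betw f (verts F) (verts F')" "edges F' = (\<lambda>e. f ` e) ` edges F"
      unfolding isomorphic_def by blast
    have "inj_on f (verts F)" "f ` verts F \<subseteq> verts G" "\<forall>e\<in>edges F. f ` e \<in> edges G"
      using f sub unfolding subhypergraph_def bij_betw_def by auto
    then show ?thesis unfolding embeds_def by (intro exI conjI)
  qed
  moreover have "\<exists>F'. subhypergraph F' G \<and> isomorphic F F'" if emb: "embeds F G"
  proof -
    from emb obtain \<phi> where \<phi>: "inj_on \<phi> (verts F)" "\<phi> ` verts F \<subseteq> verts G" "\<forall>e\<in>edges F. \<phi> ` e \<in> edges G"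
      unfolding embeds_def by blast
    let ?H = "Hypergraph (\<phi> ` verts F) ((`) \<phi> ` edges F)"
    have "subhypergraph ?H G" using \<phi> unfolding subhypergraph_def by auto
    moreover have "isomorphic F ?H"
      unfolding isomorphic_def using \<phi>(1) by (intro exI[of _ \<phi>]) (simp add: bij_betw_def)
    ultimately show ?thesis by (intro exI conjI)
  qed
  ultimately show ?thesis unfolding free_of_def by metis
qed

lemma simplicial_complexD:
  assumes "simplicial_complex G"
  shows "finite (verts G)" "finite (edges G)" "{} \<in> edges G"
    "\<And>v. v \<in> verts G \<Longrightarrow> {v} \<in> edges G"
    "\<And>e. e \<in> edges G \<Longrightarrow> e \<subseteq> verts G"
    "\<And>e. e \<in> edges G \<Longrightarrow> finite e"
    "\<And>e e'. e \<in> edges G \<Longrightarrow> e' \<subseteq> e \<Longrightarrow> e' \<in> edges G"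
proof -
  show f: "finite (verts G)" using assms by (simp add: simplicial_complex_def is_hypergraph_def)
  have s: "edges G \<subseteq> Pow (verts G)"
    using assms by (simp add: simplicial_complex_def is_hypergraph_def)
  show "finite (edges G)" using f s by (meson finite_Pow_iff finite_subset)
  show "{} \<in> edges G" "\<And>v. v \<in> verts G \<Longrightarrow> {v} \<in> edges G"
    "\<And>e e'. e \<in> edges G \<Longrightarrow> e' \<subseteq> e \<Longrightarrow> e' \<in> edges G"
    using assms by (auto simp: simplicial_complex_def)
  show "\<And>e. e \<in> edges G \<Longrightarrow> e \<subseteq> verts G" using s by blast
  then show "\<And>e. e \<in> edges G \<Longrightarrow> finite e" using f finite_subset by blast
qed

lemma edge_below_maximal_edge:
  assumes "simplicial_complex F" and "e \<in> edges F"
  obtains m where "m \<in> maximal_edges F" "e \<subseteq> m"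
proof -
  have "finite {e' \<in> edges F. e \<subseteq> e'}" using simplicial_complexD(2)[OF assms(1)] by simp
  moreover have "{e' \<in> edges F. e \<subseteq> e'} \<noteq> {}" using assms by blast
  ultimately obtain m where m: "m \<in> {e' \<in> edges F. e \<subseteq> e'}"
    "\<forall>b\<in>{e' \<in> edges F. e \<subseteq> e'}. m \<subseteq> b \<longrightarrow> m = b"
    by (rule finite_has_maximal[THEN bexE])
  then have "m \<in> maximal_edges F" "e \<subseteq> m"
    unfolding maximal_edges_def by auto
  then show ?thesis by (rule that)
qed

lemma Union_maximal_edges:
  assumes "simplicial_complex F"
  shows "\<Union> (maximal_edges F) = verts F"
proof
  show "\<Union> (maximal_edges F) \<subseteq> verts F"
    unfolding maximal_edges_def using simplicial_complexD(5)[OF assms] by blast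
  show "verts F \<subseteq> \<Union> (maximal_edges F)"
  proof
    fix v assume "v \<in> verts F"
    then have "{v} \<in> edges F" by (rule simplicial_complexD(4)[OF assms])
    then obtain m where "m \<in> maximal_edges F" "{v} \<subseteq> m"
      by (rule edge_below_maximal_edge[OF assms])
    then show "v \<in> \<Union> (maximal_edges F)" by blast
  qed
qed

text \<open>Every edge lies below a maximal one and \<open>G\<close> is closed under subsets, so
  only the maximal edges have to be checked; their union is the whole vertex set, which settles the
  vertices too.\<close>

lemma embedsI_maximal:
  assumes F: "simplicial_complex F" and G: "simplicial_complex G"
    and inj: "inj_on \<phi> (\<Union> (maximal_edges F))"
    and img: "\<And>e. e \<in> maximal_edges F \<Longrightarrow> \<phi> ` e \<in> edges G"
  shows "embeds F G"
  unfolding embeds_def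
proof (intro exI[of _ \<phi>] conjI ballI)
  show "inj_on \<phi> (verts F)" using inj Union_maximal_edges[OF F] by simp
  show "\<phi> ` verts F \<subseteq> verts G"
    unfolding Union_maximal_edges[OF F, symmetric]
    using img simplicial_complexD(5)[OF G] by blast
  fix e assume "e \<in> edges F"
  then obtain m where "m \<in> maximal_edges F" "e \<subseteq> m"
    by (rule edge_below_maximal_edge[OF F])
  then show "\<phi> ` e \<in> edges G"
    using simplicial_complexD(7)[OF G img, of m "\<phi> ` e"] by blast
qed

lemma card_edge_le_dim:
  assumes "simplicial_complex F" "complex_dim F = int k - 1" "e \<in> edges F"
  shows "card e \<le> k"
proof -
  have "card e \<le> Max (card ` edges F)"
    using assms simplicial_complexD(2)[OF assms(1)] by (intro Max_ge) auto
  then show ?thesis using assms(2) unfolding complex_dim_def by linarith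
qed

lemma exists_edge_card_dim:
  assumes "simplicial_complex F" "complex_dim F = int k - 1"
  obtains e where "e \<in> edges F" "card e = k"
proof -
  have "Max (card ` edges F) \<in> card ` edges F"
    using simplicial_complexD(2,3)[OF assms(1)] by (intro Max_in) auto
  moreover have "Max (card ` edges F) = k" using assms(2) unfolding complex_dim_def by linarith
  ultimately show ?thesis using that by auto
qed

lemma uniform_part_subset_maximal:
  assumes "simplicial_complex F" "complex_dim F = int k - 1"
  shows "edges (uniform_part F k) \<subseteq> maximal_edges F"
proof
  fix e assume "e \<in> edges (uniform_part F k)"
  then have e: "e \<in> edges F" "card e = k" by (auto simp: uniform_part_def)
  have "e' = e" if "e' \<in> edges F" "e \<subseteq> e'" for e'
    using card_seteq[of e' e] card_edge_le_dim[OF assms that(1)] e that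
      simplicial_complexD(6)[OF assms(1) that(1)] by simp
  with e show "e \<in> maximal_edges F" unfolding maximal_edges_def by blast
qed

lemma simplicial_complex_Collect:
  assumes "finite V" and "{} \<in> E" and "\<And>v. v \<in> V \<Longrightarrow> {v} \<in> E"
    and "\<And>e. e \<in> E \<Longrightarrow> e \<subseteq> V" and "\<And>e e'. e \<in> E \<Longrightarrow> e' \<subseteq> e \<Longrightarrow> e' \<in> E"
  shows "simplicial_complex (Hypergraph V E)"
  using assms unfolding simplicial_complex_def is_hypergraph_def by auto

lemma not_embeds_if_no_k_edge:
  assumes "simplicial_complex F" "complex_dim F = int k - 1" "\<And>e. e \<in> edges G \<Longrightarrow> card e \<noteq> k"
  shows "\<not> embeds F G"
proof
  assume "embeds F G"
  then obtain \<phi> where \<phi>: "inj_on \<phi> (verts F)" "\<forall>e\<in>edges F. \<phi> ` e \<in> edges G"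
    unfolding embeds_def by blast
  obtain e where e: "e \<in> edges F" "card e = k" by (rule exists_edge_card_dim[OF assms(1,2)])
  then have "card (\<phi> ` e) = k"
    using \<phi>(1) simplicial_complexD(5)[OF assms(1) e(1)] by (metis card_image inj_on_subset)
  then show False using assms(3) \<phi>(2) e(1) by blast
qed

subsection \<open>The extremal functions\<close>

lemma finite_if_nat_bounded:
  assumes "\<And>x. x \<in> A \<Longrightarrow> x \<le> (b::nat)"
  shows "finite A"
  using assms by (meson finite_nat_set_iff_bounded_le)

lemma ex_complex_finite:
  "finite {card (edges G) | G :: nat hypergraph.
     simplicial_complex G \<and> card (verts G) = n \<and> free_of F G}" (is "finite ?C")
proof -
  have "x \<le> 2 ^ n" if "x \<in> ?C" for x
  proof -
    from that obtain G :: "nat hypergraph" where G: "x = card (edges G)" "simplicial_complex G" "card (verts G) = n"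
      by blast
    have "edges G \<subseteq> Pow (verts G)" using simplicial_complexD(5)[OF G(2)] by blast
    then have "card (edges G) \<le> card (Pow (verts G))"
      using simplicial_complexD(1)[OF G(2)] by (intro card_mono) auto
    then show ?thesis using G simplicial_complexD(1)[OF G(2)] by (simp add: card_Pow)
  qed
  then show ?thesis by (rule finite_if_nat_bounded)
qed

lemma ex_complex_ge:
  fixes G :: "nat hypergraph"
  assumes "simplicial_complex G" "card (verts G) = n" "\<not> embeds F G"
  shows "card (edges G) \<le> ex_complex n F"
  unfolding ex_complex_def using assms free_of_iff[of F G]
  by (intro Max_ge ex_complex_finite) blast

text \<open>The hypotheses exhibit one competitor, which makes the finite set under
  \<open>Max\<close> nonempty.\<close>

lemma ex_complex_attained:
  fixes G :: "nat hypergraph"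
  assumes "simplicial_complex G" "card (verts G) = n" "\<not> embeds F G"
  obtains G' :: "nat hypergraph" where "simplicial_complex G'" "card (verts G') = n" "\<not> embeds F G'"
    "card (edges G') = ex_complex n F"
proof -
  have "ex_complex n F \<in> {card (edges G) | G :: nat hypergraph.
     simplicial_complex G \<and> card (verts G) = n \<and> free_of F G}"
    unfolding ex_complex_def using assms free_of_iff[of F G]
    by (intro Max_in ex_complex_finite) blast
  then obtain G' :: "nat hypergraph" where "ex_complex n F = card (edges G')"
    "simplicial_complex G'" "card (verts G') = n" "free_of F G'" by blast
  then show ?thesis using that[of G'] free_of_iff[of F G'] by simp
qed

lemma ex_clique_plus_finite:
  "finite {card {T. is_clique k G T \<and> k \<le> card T} | G :: nat hypergraph.
     uniform_hypergraph k G \<and> card (verts G) = n \<and> free_of H G}" (is "finite ?C")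
proof -
  have "x \<le> 2 ^ n" if "x \<in> ?C" for x
  proof -
    from that obtain G :: "nat hypergraph" where G: "x = card {T. is_clique k G T \<and> k \<le> card T}"
      "uniform_hypergraph k G" "card (verts G) = n" by blast
    have fin: "finite (verts G)" using G(2) by (simp add: uniform_hypergraph_def is_hypergraph_def)
    have "{T. is_clique k G T \<and> k \<le> card T} \<subseteq> Pow (verts G)" unfolding is_clique_def by blast
    then have "x \<le> card (Pow (verts G))"
      unfolding G(1) using fin by (intro card_mono) auto
    then show ?thesis using G fin by (simp add: card_Pow)
  qed
  then show ?thesis by (rule finite_if_nat_bounded)
qed

lemma ex_clique_plus_ge:
  fixes G :: "nat hypergraph"
  assumes "uniform_hypergraph k G" "card (verts G) = n" "\<not> embeds H G"
  shows "card {T. is_clique k G T \<and> k \<le> card T} \<le> ex_clique_plus k n H"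
  unfolding ex_clique_plus_def using assms free_of_iff[of H G]
  by (intro Max_ge ex_clique_plus_finite) blast

lemma ex_clique_plus_attained:
  fixes G :: "nat hypergraph"
  assumes "uniform_hypergraph k G" "card (verts G) = n" "\<not> embeds H G"
  obtains G' :: "nat hypergraph" where "uniform_hypergraph k G'" "card (verts G') = n" "\<not> embeds H G'"
    "card {T. is_clique k G' T \<and> k \<le> card T} = ex_clique_plus k n H"
proof -
  have "ex_clique_plus k n H \<in> {card {T. is_clique k G T \<and> k \<le> card T} | G :: nat hypergraph.
     uniform_hypergraph k G \<and> card (verts G) = n \<and> free_of H G}"
    unfolding ex_clique_plus_def using assms free_of_iff[of H G]
    by (intro Max_in ex_clique_plus_finite) blast
  then obtain G' :: "nat hypergraph" where
    "ex_clique_plus k n H = card {T. is_clique k G' T \<and> k \<le> card T}"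
    "uniform_hypergraph k G'" "card (verts G') = n" "free_of H G'" by blast
  then show ?thesis using that[of G'] free_of_iff[of H G'] by simp
qed

subsection \<open>Counting sets of vertices\<close>

definition binom_sum :: "nat \<Rightarrow> nat \<Rightarrow> nat" where
  "binom_sum n m = (\<Sum>r<m. n choose r)"

lemma card_subsets_less:
  assumes "finite V"
  shows "card {T. T \<subseteq> V \<and> card T < m} = binom_sum (card V) m"
proof -
  have "{T. T \<subseteq> V \<and> card T < m} = (\<Union>r<m. {T. T \<subseteq> V \<and> card T = r})" by auto
  also have "card \<dots> = (\<Sum>r<m. card {T. T \<subseteq> V \<and> card T = r})"
    using assms by (intro card_UN_disjoint) auto
  also have "\<dots> = binom_sum (card V) m"
    unfolding binom_sum_def using assms by (simp add: n_subsets)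
  finally show ?thesis .
qed

text \<open>A set \<open>T\<close> is determined by its trace on \<open>W\<close> and its part off
  \<open>W\<close>. For \<open>W\<close> of bounded size this leaves only O(n^(m-1)) sets, which is
  how edges clustering around a bounded set are discarded.\<close>

lemma card_near_subsets_le:
  assumes "finite V" "finite W"
  shows "card {T. T \<subseteq> V \<and> card (T - W) < m} \<le> 2 ^ card W * binom_sum (card V) m"
proof -
  let ?f = "\<lambda>T. (T \<inter> W, T - W)"
  have "card {T. T \<subseteq> V \<and> card (T - W) < m} \<le> card (Pow W \<times> {T. T \<subseteq> V \<and> card T < m})"
  proof (rule card_inj_on_le[where f = ?f])
    show "inj_on ?f {T. T \<subseteq> V \<and> card (T - W) < m}" by (rule inj_onI) blast
    show "finite (Pow W \<times> {T. T \<subseteq> V \<and> card T < m})"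
      using assms by (auto intro: finite_subset[of _ "Pow V"])
  qed auto
  then show ?thesis
    by (simp add: card_cartesian_product card_Pow card_subsets_less assms)
qed

lemma obtain_subset_between:
  assumes "A \<subseteq> C" "finite C" "card A \<le> n" "n \<le> card C"
  obtains B where "A \<subseteq> B" "B \<subseteq> C" "card B = n"
  using exists_subset_between[OF assms(3,4,1,2)] by blast

section \<open>Asymptotic comparison of binomial coefficients\<close>

lemma binomial_tendsto:
  "(\<lambda>n. real ((n - c) choose p) / real n ^ p) \<longlonglongrightarrow> 1 / fact p"
proof -
  have "(\<lambda>n. (real n - real (c + i)) / real n) \<longlonglongrightarrow> 1 - 0" for i
  proof (rule Lim_transform_eventually)
    show "(\<lambda>n. 1 - real (c + i) / real n) \<longlonglongrightarrow> 1 - 0"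
      by (intro tendsto_intros lim_const_over_n)
    show "\<forall>\<^sub>F n in sequentially. 1 - real (c + i) / real n = (real n - real (c + i)) / real n"
      using eventually_gt_at_top[of 0] by eventually_elim (simp add: field_simps)
  qed
  then have "(\<lambda>n. (\<Prod>i<p. (real n - real (c + i)) / real n) / fact p) \<longlonglongrightarrow> (\<Prod>i<p. 1) / fact p"
    by (intro tendsto_intros) simp_all
  then have "(\<lambda>n. (\<Prod>i<p. (real n - real (c + i)) / real n) / fact p) \<longlonglongrightarrow> 1 / fact p"
    by simp
  then show ?thesis
  proof (rule Lim_transform_eventually)
    show "\<forall>\<^sub>F n in sequentially. (\<Prod>i<p. (real n - real (c + i)) / real n) / fact p
      = real ((n - c) choose p) / real n ^ p"
      using eventually_ge_at_top[of c]
    proof eventually_elim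
      case (elim n)
      have "real ((n - c) choose p) = (\<Prod>i<p. real (n - c) - real i) / fact p"
        by (simp add: binomial_gbinomial gbinomial_prod_rev atLeast0LessThan)
      also have "(\<Prod>i<p. real (n - c) - real i) = (\<Prod>i<p. real n - real (c + i))"
        using elim by (intro prod.cong) (auto simp: of_nat_diff)
      finally show ?case by (simp add: prod_dividef)
    qed
  qed
qed

lemma binom_sum_tendsto:
  "(\<lambda>n. real (binom_sum n p) / real n ^ p) \<longlonglongrightarrow> 0"
proof -
  have "(\<lambda>n. real (n choose r) / real n ^ p) \<longlonglongrightarrow> 0" if r: "r < p" for r
  proof -
    have "(\<lambda>n. real (n choose r) / real n ^ r * (1 / real n) ^ (p - r)) \<longlonglongrightarrow> 1 / fact r * 0 ^ (p - r)"
      using binomial_tendsto[of 0 r] lim_const_over_n[of "1::real"]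
      by (intro tendsto_mult tendsto_power) simp_all
    then have "(\<lambda>n. real (n choose r) / real n ^ r * (1 / real n) ^ (p - r)) \<longlonglongrightarrow> 0"
      using r by (simp add: power_0_left)
    moreover have "real (n choose r) / real n ^ r * (1 / real n) ^ (p - r) = real (n choose r) / real n ^ p" for n
      using r by (simp add: power_one_over field_simps flip: power_add)
    ultimately show ?thesis by simp
  qed
  then have "(\<lambda>n. \<Sum>r<p. real (n choose r) / real n ^ p) \<longlonglongrightarrow> (\<Sum>r<p. 0)"
    by (intro tendsto_sum) auto
  then show ?thesis by (simp add: binom_sum_def sum_divide_distrib)
qed

lemma eventually_le_of_tendsto:
  fixes f g :: "nat \<Rightarrow> nat"
  assumes "(\<lambda>n. real (f n) / real n ^ p) \<longlonglongrightarrow> a" "(\<lambda>n. real (g n) / real n ^ p) \<longlonglongrightarrow> b" "a < b"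
  shows "\<forall>\<^sub>F n in sequentially. f n \<le> g n"
proof -
  obtain c where c: "a < c" "c < b" using assms(3) dense by blast
  show ?thesis
    using order_tendstoD(2)[OF assms(1) c(1)] order_tendstoD(1)[OF assms(2) c(2)] eventually_gt_at_top[of 0]
  proof eventually_elim
    case (elim n)
    then have "real (f n) / real n ^ p < real (g n) / real n ^ p" by linarith
    then have "real (f n) < real (g n)" using elim(3) by (simp add: divide_less_cancel)
    then show ?case by simp
  qed
qed

lemma eventually_binom_sum_le_binomial:
  "\<forall>\<^sub>F n in sequentially. K * binom_sum n p \<le> (n - c) choose p"
proof (rule eventually_le_of_tendsto)
  have "(\<lambda>n. real K * (real (binom_sum n p) / real n ^ p)) \<longlonglongrightarrow> real K * 0"
    by (intro tendsto_mult tendsto_const binom_sum_tendsto)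
  then show "(\<lambda>n. real (K * binom_sum n p) / real n ^ p) \<longlonglongrightarrow> 0" by simp
qed (rule binomial_tendsto, simp)

text \<open>Both sides have order n^(p+1), so leading coefficients are compared: 1/p! on the left
  against (p+2)/(p+1)! on the right, that is p+1 against p+2. In the application \<open>p\<close> is
  \<open>k - 3\<close>.\<close>

lemma eventually_pair_degree_bound:
  "\<forall>\<^sub>F n in sequentially.
     n * ((n choose p) + K * binom_sum n p) \<le> (p + 2) * ((n - c) choose Suc p)"
proof (rule eventually_le_of_tendsto)
  have "(\<lambda>n. real (n choose p) / real n ^ p + real K * (real (binom_sum n p) / real n ^ p))
      \<longlonglongrightarrow> 1 / fact p + real K * 0"
    using binomial_tendsto[of 0 p] by (intro tendsto_add tendsto_mult tendsto_const binom_sum_tendsto) simp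
  then have "(\<lambda>n. real (n choose p) / real n ^ p + real K * (real (binom_sum n p) / real n ^ p))
      \<longlonglongrightarrow> 1 / fact p" by simp
  then show "(\<lambda>n. real (n * ((n choose p) + K * binom_sum n p)) / real n ^ Suc p) \<longlonglongrightarrow> 1 / fact p"
  proof (rule Lim_transform_eventually)
    show "\<forall>\<^sub>F n in sequentially. real (n choose p) / real n ^ p + real K * (real (binom_sum n p) / real n ^ p)
      = real (n * ((n choose p) + K * binom_sum n p)) / real n ^ Suc p"
      using eventually_gt_at_top[of 0] by eventually_elim (simp add: field_simps)
  qed
  have "(\<lambda>n. real (p + 2) * (real ((n - c) choose Suc p) / real n ^ Suc p))
      \<longlonglongrightarrow> real (p + 2) * (1 / fact (Suc p))"
    by (intro tendsto_mult tendsto_const binomial_tendsto)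
  then show "(\<lambda>n. real ((p + 2) * ((n - c) choose Suc p)) / real n ^ Suc p)
      \<longlonglongrightarrow> real (p + 2) * (1 / fact (Suc p))"
    by (simp only: of_nat_mult times_divide_eq_right)
  have "(1::real) / fact p = real (p + 1) * (1 / fact (Suc p))"
    by (simp add: divide_simps)
  also have "\<dots> < real (p + 2) * (1 / fact (Suc p))"
    by (intro mult_strict_right_mono) (simp_all del: fact_Suc)
  finally show "1 / fact p < real (p + 2) * (1 / fact (Suc p))" .
qed

text \<open>Copies are assembled from disjoint cells, each mapped into a target cell of its own.
  Inequalities between the sizes are enough because the hosts are closed under subsets.\<close>

lemma disjoint_family_embedding:
  fixes X :: "'i \<Rightarrow> 'a set" and Y :: "'i \<Rightarrow> 'b set"
  assumes fin: "\<And>i. i \<in> I \<Longrightarrow> finite (X i)" "\<And>i. i \<in> I \<Longrightarrow> finite (Y i)"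
    and disj: "disjoint_family_on X I" "disjoint_family_on Y I"
    and card: "\<And>i. i \<in> I \<Longrightarrow> card (X i) \<le> card (Y i)"
  obtains \<phi> where "inj_on \<phi> (\<Union>i\<in>I. X i)" "\<And>i. i \<in> I \<Longrightarrow> \<phi> ` X i \<subseteq> Y i"
proof -
  have "\<forall>i\<in>I. \<exists>f. f ` X i \<subseteq> Y i \<and> inj_on f (X i)"
    by (intro ballI card_le_inj fin card)
  then obtain g where g: "\<And>i. i \<in> I \<Longrightarrow> g i ` X i \<subseteq> Y i" "\<And>i. i \<in> I \<Longrightarrow> inj_on (g i) (X i)"
    by metis
  \<comment> \<open>Disjointness makes the index of the cell containing \<open>x\<close> unique, so
    the maps \<open>g i\<close> glue to one map.\<close>
  define \<phi> where "\<phi> x = g (THE i. i \<in> I \<and> x \<in> X i) x" for x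
  have \<phi>: "\<phi> x = g i x" if "i \<in> I" "x \<in> X i" for i x
  proof -
    have "(THE i. i \<in> I \<and> x \<in> X i) = i"
      using that disj(1) unfolding disjoint_family_on_def by (intro the_equality) blast+
    then show ?thesis by (simp add: \<phi>_def)
  qed
  have img: "\<phi> ` X i \<subseteq> Y i" if "i \<in> I" for i using g(1)[OF that] \<phi>[OF that] by auto
  have "inj_on \<phi> (\<Union>i\<in>I. X i)"
  proof (rule inj_onI)
    fix x y assume "x \<in> (\<Union>i\<in>I. X i)" "y \<in> (\<Union>i\<in>I. X i)" and eq: "\<phi> x = \<phi> y"
    then obtain i j where ij: "i \<in> I" "x \<in> X i" "j \<in> I" "y \<in> X j" by blast
    have "\<phi> x \<in> Y i" "\<phi> y \<in> Y j" using img ij by blast+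
    then have "i = j" using disj(2) ij eq unfolding disjoint_family_on_def by (metis disjoint_iff)
    then show "x = y" using g(2)[OF ij(1)] \<phi> ij eq by (metis inj_onD)
  qed
  then show ?thesis using that img by blast
qed

section \<open>Double counting and disjoint subfamilies\<close>

lemma double_counting:
  assumes "finite A" "finite B"
    and "\<And>a. a \<in> A \<Longrightarrow> (c::nat) \<le> card {b \<in> B. R a b}"
    and "\<And>b. b \<in> B \<Longrightarrow> card {a \<in> A. R a b} \<le> d"
  shows "card A * c \<le> card B * d"
proof -
  have "card A * c \<le> (\<Sum>a\<in>A. card {b \<in> B. R a b})"
    using sum_bounded_below[of A c "\<lambda>a. card {b \<in> B. R a b}"] assms(3) by simp
  also have "\<dots> = (\<Sum>b\<in>B. card {a \<in> A. R a b})"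
    using sum.swap_restrict[OF assms(1,2), of "\<lambda>_ _. 1::nat" R] by simp
  also have "\<dots> \<le> card B * d"
    using sum_bounded_above[of B "\<lambda>b. card {a \<in> A. R a b}" d] assms(4) by simp
  finally show ?thesis .
qed

lemma double_counting_card_le:
  assumes "finite A" "finite B"
    and "\<And>a. a \<in> A \<Longrightarrow> (c::nat) \<le> card {b \<in> B. R a b}"
    and "\<And>b. b \<in> B \<Longrightarrow> card {a \<in> A. R a b} \<le> d"
    and "d \<le> c" "0 < c"
  shows "card A \<le> card B"
proof -
  have "card A * c \<le> card B * d"
    using assms(1-4) by (rule double_counting)
  also have "\<dots> \<le> card B * c" using assms(5) by simp
  finally show ?thesis using assms(6) by simp
qed

lemma card_Union_uniform_le:
  assumes "\<And>e. e \<in> M \<Longrightarrow> card e \<le> (k::nat)"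
  shows "card (\<Union> M) \<le> card M * k"
proof (cases "finite M")
  case True
  have "card (\<Union> M) \<le> sum card M" by (rule card_Union_le_sum_card)
  also have "\<dots> \<le> card M * k" using sum_bounded_above[of M card k] assms by simp
  finally show ?thesis .
next
  \<comment> \<open>For infinite \<open>M\<close> the right side is 0, but then
    \<open>\<Union> M\<close> is infinite as well and its \<open>card\<close> is also 0.\<close>
  case inf: False
  then show ?thesis
  proof (cases "finite (\<Union> M)")
    case True
    then show ?thesis using inf finite_UnionD by blast
  qed simp
qed

text \<open>A disjoint subfamily that cannot be enlarged hits every nonempty member. If the members
  have bounded size, a bound on disjoint subfamilies thus yields a bounded transversal.\<close>

lemma maximal_disjoint_subfamily:
  assumes "finite E"
  obtains N where "N \<subseteq> E" "pairwise disjnt N" "\<And>e. e \<in> E \<Longrightarrow> e \<noteq> {} \<Longrightarrow> e \<inter> \<Union> N \<noteq> {}"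
proof -
  let ?S = "{N. N \<subseteq> E \<and> pairwise disjnt N}"
  have "finite ?S" using assms by (auto intro: finite_subset[of _ "Pow E"])
  moreover have "{} \<in> ?S" by simp
  ultimately obtain N where N: "N \<in> ?S" "\<forall>b\<in>?S. N \<subseteq> b \<longrightarrow> N = b"
    using finite_has_maximal[of ?S] by (metis (lifting) empty_iff)
  have "e \<inter> \<Union> N \<noteq> {}" if e: "e \<in> E" "e \<noteq> {}" for e
  proof
    assume d: "e \<inter> \<Union> N = {}"
    then have "pairwise disjnt (insert e N)"
      using N(1) unfolding pairwise_insert disjnt_def by blast
    then have "N = insert e N" using N e by blast
    then show False using d e by blast
  qed
  then show ?thesis using that N(1) by blast
qed

subsection \<open>A criterion for triviality\<close>

lemma card_edges_split:
  assumes "simplicial_complex G"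
  shows "card (edges G) = card {T \<in> edges G. card T < k} + card {T \<in> edges G. k \<le> card T}"
proof -
  have "edges G = {T \<in> edges G. card T < k} \<union> {T \<in> edges G. k \<le> card T}" by auto
  then show ?thesis
    using card_Un_disjoint[of "{T \<in> edges G. card T < k}" "{T \<in> edges G. k \<le> card T}"]
      simplicial_complexD(2)[OF assms] by fastforce
qed

text \<open>Edges with at least \<open>k\<close> vertices are traded for absent
  \<open>m\<close>-sets: these and the small edges are disjoint families of sets with fewer than
  \<open>k\<close> vertices.\<close>

lemma edges_count_bound:
  assumes G: "simplicial_complex G" and m: "m < k"
    and le: "card {D \<in> edges G. k \<le> card D} \<le> card {B. B \<subseteq> verts G \<and> card B = m \<and> B \<notin> edges G}"
  shows "card (edges G) \<le> binom_sum (card (verts G)) k"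
proof -
  have fin: "finite {T. T \<subseteq> verts G \<and> P T}" for P
    using simplicial_complexD(1)[OF G] by (auto intro: finite_subset[of _ "Pow (verts G)"])
  have "card {T \<in> edges G. card T < k} + card {B. B \<subseteq> verts G \<and> card B = m \<and> B \<notin> edges G}
      = card ({T \<in> edges G. card T < k} \<union> {B. B \<subseteq> verts G \<and> card B = m \<and> B \<notin> edges G})"
    using simplicial_complexD(2)[OF G] fin by (intro card_Un_disjoint[symmetric]) auto
  also have "\<dots> \<le> card {T. T \<subseteq> verts G \<and> card T < k}"
    using m simplicial_complexD(5)[OF G] by (intro card_mono fin) auto
  finally show ?thesis
    using le card_edges_split[OF G, of k] card_subsets_less[OF simplicial_complexD(1)[OF G], of k] by linarith
qed

lemma card_small_edges_le:
  assumes "simplicial_complex G"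
  shows "card {T \<in> edges G. card T < k} \<le> binom_sum (card (verts G)) k"
  unfolding card_subsets_less[OF simplicial_complexD(1)[OF assms], symmetric]
  using simplicial_complexD(1,5)[OF assms]
  by (intro card_mono) (auto intro: finite_subset[of _ "Pow (verts G)"])

text \<open>A competitor without \<open>k\<close>-edges contains no copy. It keeps the sets under
  \<open>Max\<close> nonempty and provides the lower bound in (a).\<close>

lemma exists_complex_without_k_edge:
  assumes "k \<ge> 2"
  obtains G :: "nat hypergraph" where "simplicial_complex G" "card (verts G) = n"
    "\<And>e. e \<in> edges G \<Longrightarrow> card e < k" "card (edges G) = binom_sum n k"
proof -
  let ?G = "Hypergraph {..<n} {T. T \<subseteq> {..<n} \<and> card T < k}"
  have "simplicial_complex ?G"
  proof (rule simplicial_complex_Collect)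
    fix e e' assume a: "e \<in> {T. T \<subseteq> {..<n} \<and> card T < k}" and s: "e' \<subseteq> e"
    then have "finite e" by (auto intro: finite_subset)
    from card_mono[OF this s] a s show "e' \<in> {T. T \<subseteq> {..<n} \<and> card T < k}" by auto
  qed (use assms in auto)
  then show ?thesis
    by (rule that) (auto simp: card_subsets_less)
qed

lemma clique_complex:
  assumes k: "k \<ge> 2" and G: "uniform_hypergraph k G"
  defines "K \<equiv> Hypergraph (verts G)
    ({T. T \<subseteq> verts G \<and> card T < k} \<union> {T. is_clique k G T \<and> k \<le> card T})"
  shows "simplicial_complex K" "\<And>e. e \<in> edges K \<Longrightarrow> card e = k \<Longrightarrow> e \<in> edges G"
    "card (edges K) = card {T. is_clique k G T \<and> k \<le> card T} + binom_sum (card (verts G)) k"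
proof -
  have fin: "finite (verts G)" and sub: "\<And>e. e \<in> edges G \<Longrightarrow> e \<subseteq> verts G"
    and ck: "\<And>e. e \<in> edges G \<Longrightarrow> card e = k"
    using G by (auto simp: uniform_hypergraph_def is_hypergraph_def)
  have fine: "finite T" if "T \<subseteq> verts G" for T using fin finite_subset that by blast
  \<comment> \<open>On at least \<open>k\<close> vertices the first two kinds of cliques collapse:
    \<open>k \<ge> 2\<close> excludes singletons, and a \<open>k\<close>-set below a
    \<open>k\<close>-edge is that edge.\<close>
  have clique: "S \<in> edges G" if T: "is_clique k G T" "k \<le> card T" and S: "S \<subseteq> T" "card S = k" for S T
  proof -
    have TV: "T \<subseteq> verts G" using T by (simp add: is_clique_def)
    consider "\<exists>v. T = {v}" | e where "e \<in> edges G" "T \<subseteq> e"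
      | "\<forall>S. S \<subseteq> T \<and> card S = k \<longrightarrow> S \<in> edges G"
      using T by (auto simp: is_clique_def)
    then show ?thesis
    proof cases
      case 1
      then show ?thesis using T(2) k by auto
    next
      case 2
      then have "S \<subseteq> e" using S by blast
      then have "S = e" using card_subset_eq[OF fine[OF sub[OF 2(1)]]] ck[OF 2(1)] S by simp
      then show ?thesis using 2 by simp
    next
      case 3
      then show ?thesis using S by blast
    qed
  qed
  show "simplicial_complex K"
    unfolding K_def
  proof (rule simplicial_complex_Collect)
    fix e e' assume e: "e \<in> {T. T \<subseteq> verts G \<and> card T < k} \<union> {T. is_clique k G T \<and> k \<le> card T}"
      and s: "e' \<subseteq> e"
    have eV: "e \<subseteq> verts G" using e by (auto simp: is_clique_def)
    have le: "card e' \<le> card e" using card_mono[OF fine[OF eV] s] .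
    show "e' \<in> {T. T \<subseteq> verts G \<and> card T < k} \<union> {T. is_clique k G T \<and> k \<le> card T}"
    proof (cases "card e' < k")
      case True
      then show ?thesis using eV s by auto
    next
      case False
      then have "is_clique k G e" "k \<le> card e" using e le by auto
      then have "\<forall>S. S \<subseteq> e' \<and> card S = k \<longrightarrow> S \<in> edges G" using clique s by blast
      then have "is_clique k G e'" using eV s unfolding is_clique_def by auto
      then show ?thesis using False by auto
    qed
  qed (use k fin in \<open>auto simp: is_clique_def\<close>)
  show "e \<in> edges G" if "e \<in> edges K" "card e = k" for e
    using that clique[of e e] unfolding K_def by auto
  have "card (edges K) = card {T. T \<subseteq> verts G \<and> card T < k} + card {T. is_clique k G T \<and> k \<le> card T}"
    unfolding K_def hypergraph.sel using fin
    by (intro card_Un_disjoint) (auto simp: is_clique_def intro: finite_subset[of _ "Pow (verts G)"])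
  then show "card (edges K) = card {T. is_clique k G T \<and> k \<le> card T} + binom_sum (card (verts G)) k"
    by (simp add: card_subsets_less[OF fin])
qed

lemma large_edges_are_cliques:
  assumes "simplicial_complex G"
  shows "{T \<in> edges G. k \<le> card T} \<subseteq> {T. is_clique k (uniform_part G k) T \<and> k \<le> card T}"
  using simplicial_complexD(5,7)[OF assms] unfolding is_clique_def uniform_part_def by simp blast

lemma uniform_part_uniform:
  "simplicial_complex G \<Longrightarrow> uniform_hypergraph k (uniform_part G k)"
  unfolding uniform_hypergraph_def uniform_part_def simplicial_complex_def is_hypergraph_def by auto

text \<open>The lower bound comes from the clique complex, whose \<open>k\<close>-edges all belong
  to the \<open>k\<close>-graph. For the upper bound, if the \<open>k\<close>-part of a host
  contains no copy of that of \<open>F\<close>, the large edges of the host are cliques counted by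
  \<open>ex_clique_plus\<close>; \<open>bound\<close> takes care of the other hosts.\<close>

lemma trivial_complexI:
  fixes F :: "'a hypergraph"
  assumes k: "k \<ge> 2" and F: "simplicial_complex F" "complex_dim F = int k - 1"
    and bound: "\<forall>\<^sub>F n in sequentially. \<forall>G :: nat hypergraph.
      simplicial_complex G \<longrightarrow> card (verts G) = n \<longrightarrow> \<not> embeds F G \<longrightarrow>
      embeds (uniform_part F k) (uniform_part G k) \<longrightarrow> card (edges G) \<le> binom_sum n k"
  shows "trivial_complex k F"
  unfolding trivial_complex_def
proof (rule eventually_mono[OF bound])
  fix n
  assume bd: "\<forall>G :: nat hypergraph.
      simplicial_complex G \<longrightarrow> card (verts G) = n \<longrightarrow> \<not> embeds F G \<longrightarrow>
      embeds (uniform_part F k) (uniform_part G k) \<longrightarrow> card (edges G) \<le> binom_sum n k"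
  have bs: "(\<Sum>r=0..k-1. n choose r) = binom_sum n k"
    unfolding binom_sum_def using k by (intro sum.cong) auto
  obtain G0 :: "nat hypergraph" where G0: "simplicial_complex G0" "card (verts G0) = n"
    "\<And>e. e \<in> edges G0 \<Longrightarrow> card e < k"
    using exists_complex_without_k_edge[OF k] by metis
  have nG0: "\<not> embeds F G0" using not_embeds_if_no_k_edge[OF F] G0(3) by (metis nat_neq_iff)
  have nG0k: "\<not> embeds (uniform_part F k) (uniform_part G0 k)"
  proof
    assume "embeds (uniform_part F k) (uniform_part G0 k)"
    moreover obtain e where "e \<in> edges F" "card e = k" by (rule exists_edge_card_dim[OF F])
    moreover have "edges (uniform_part G0 k) = {}" using G0(3) unfolding uniform_part_def by fastforce
    ultimately show False unfolding embeds_def by (auto simp: uniform_part_def)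
  qed
  have "ex_complex n F \<le> ex_clique_plus k n (uniform_part F k) + binom_sum n k"
  proof -
    obtain G :: "nat hypergraph" where G: "simplicial_complex G" "card (verts G) = n" "\<not> embeds F G"
      "card (edges G) = ex_complex n F"
      by (rule ex_complex_attained[OF G0(1,2) nG0])
    show ?thesis
    proof (cases "embeds (uniform_part F k) (uniform_part G k)")
      case True
      then have "card (edges G) \<le> binom_sum n k" using bd G(1,2,3) by blast
      then show ?thesis using G(4) by linarith
    next
      case False
      have cV: "card (verts (uniform_part G k)) = n" using G(2) by (simp add: uniform_part_def)
      have "finite {T. is_clique k (uniform_part G k) T \<and> k \<le> card T}"
        using simplicial_complexD(1)[OF G(1)]
        by (auto simp: is_clique_def uniform_part_def intro: finite_subset[of _ "Pow (verts G)"])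
      then have "card {T \<in> edges G. k \<le> card T} \<le> card {T. is_clique k (uniform_part G k) T \<and> k \<le> card T}"
        by (intro card_mono large_edges_are_cliques G)
      also have "\<dots> \<le> ex_clique_plus k n (uniform_part F k)"
        using False G uniform_part_uniform cV by (intro ex_clique_plus_ge) auto
      finally show ?thesis
        using card_edges_split[OF G(1), of k] card_small_edges_le[OF G(1), of k] unfolding G(2,4) by linarith
    qed
  qed
  moreover have "ex_clique_plus k n (uniform_part F k) + binom_sum n k \<le> ex_complex n F"
  proof -
    have "card (verts (uniform_part G0 k)) = n" using G0(2) by (simp add: uniform_part_def)
    then obtain G :: "nat hypergraph" where G: "uniform_hypergraph k G" "card (verts G) = n"
      "\<not> embeds (uniform_part F k) G"
      "card {T. is_clique k G T \<and> k \<le> card T} = ex_clique_plus k n (uniform_part F k)"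
      by (rule ex_clique_plus_attained[OF uniform_part_uniform[OF G0(1)] _ nG0k])
    define K where "K = Hypergraph (verts G)
      ({T. T \<subseteq> verts G \<and> card T < k} \<union> {T. is_clique k G T \<and> k \<le> card T})"
    note K = clique_complex[OF k G(1), folded K_def]
    have VK: "verts K = verts G" by (simp add: K_def)
    have "\<not> embeds F K"
    proof
      assume "embeds F K"
      then obtain \<phi> where \<phi>: "inj_on \<phi> (verts F)" "\<phi> ` verts F \<subseteq> verts K" "\<forall>e\<in>edges F. \<phi> ` e \<in> edges K"
        unfolding embeds_def by blast
      have "\<phi> ` e \<in> edges G" if e: "e \<in> edges F" "card e = k" for e
      proof (rule K(2))
        show "\<phi> ` e \<in> edges K" using \<phi>(3) e by blast
        show "card (\<phi> ` e) = k"
          using \<phi>(1) simplicial_complexD(5)[OF F(1) e(1)] e(2) by (metis card_image inj_on_subset)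
      qed
      then have "embeds (uniform_part F k) G"
        using \<phi> VK unfolding embeds_def uniform_part_def by auto
      then show False using G(3) by contradiction
    qed
    then have "card (edges K) \<le> ex_complex n F"
      using K(1) VK G(2) by (intro ex_complex_ge) auto
    then show ?thesis using K(3) G by simp
  qed
  ultimately show "ex_complex n F = ex_clique_plus k n (uniform_part F k) + (\<Sum>r = 0..k - 1. n choose r)"
    using bs by simp
qed

lemma trivial_if_pure:
  fixes F :: "'a hypergraph"
  assumes k: "k \<ge> 2" and F: "simplicial_complex F" "complex_dim F = int k - 1"
    and pure: "maximal_edges F = edges (uniform_part F k)"
  shows "trivial_complex k F"
proof (rule trivial_complexI[OF k F], intro always_eventually allI impI)
  fix n and G :: "nat hypergraph"
  assume G: "simplicial_complex G" "\<not> embeds F G" "embeds (uniform_part F k) (uniform_part G k)"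
  then obtain \<phi> where \<phi>: "inj_on \<phi> (verts F)" "\<forall>e\<in>maximal_edges F. \<phi> ` e \<in> edges G"
    unfolding embeds_def pure by (auto simp: uniform_part_def)
  then have "embeds F G"
    using Union_maximal_edges[OF F(1)] by (intro embedsI_maximal[OF F(1) G(1), of \<phi>]) auto
  then show "card (edges G) \<le> binom_sum n k" using G(2) by blast
qed

subsection \<open>Disjoint maximal edges\<close>

text \<open>Once \<open>M\<close> has received the \<open>k\<close>-edges of \<open>F\<close>, the
  other maximal edges have at most \<open>k - 1\<close> vertices and would fit into disjoint
  \<open>(k-1)\<close>-edges away from \<open>M\<close>. Hence fewer than \<open>card S0\<close> of
  those can be disjoint, and a maximal choice of them spans, together with \<open>M\<close>, a
  bounded set that no \<open>(k-1)\<close>-edge avoids. The hypothesis speaks of a matching so that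
  the exact formula can use the bound as well.\<close>

lemma disjoint_maximal_edges_bound:
  fixes F :: "'a hypergraph"
  assumes k: "k \<ge> 2" and F: "simplicial_complex F" "complex_dim F = int k - 1"
    and disj: "pairwise disjnt (maximal_edges F)"
  shows "\<forall>\<^sub>F n in sequentially. \<forall>G :: nat hypergraph.
      simplicial_complex G \<longrightarrow> card (verts G) = n \<longrightarrow> \<not> embeds F G \<longrightarrow>
      (\<exists>M \<subseteq> edges G. pairwise disjnt M \<and> (\<forall>e\<in>M. card e = k) \<and> card M = card (edges (uniform_part F k)))
      \<longrightarrow> card (edges G) \<le> binom_sum n k"
proof -
  let ?M0 = "edges (uniform_part F k)"
  define S0 where "S0 = maximal_edges F - ?M0"
  \<comment> \<open>An upper bound for the size of the set \<open>W\<close> below: \<open>M\<close>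
    has \<open>card ?M0\<close> edges, and \<open>N\<close> turns out to have fewer than
    \<open>card S0\<close>.\<close>
  define c where "c = card ?M0 * k + card S0 * (k - 1)"
  have M0: "?M0 \<subseteq> maximal_edges F" by (rule uniform_part_subset_maximal[OF F])
  have max_sub: "maximal_edges F \<subseteq> edges F" by (auto simp: maximal_edges_def)
  have fin_max: "finite (maximal_edges F)"
    using max_sub simplicial_complexD(2)[OF F(1)] finite_subset by blast
  then have fin0: "finite ?M0" "finite S0" using M0 finite_subset by (auto simp: S0_def)
  have split0: "maximal_edges F = ?M0 \<union> S0" "?M0 \<inter> S0 = {}" using M0 by (auto simp: S0_def)
  show ?thesis
  proof (rule eventually_mono[OF eventually_binom_sum_le_binomial[of "2 ^ c" "k - 1" 0]], intro allI impI)
    fix n and G :: "nat hypergraph"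
    assume ev: "2 ^ c * binom_sum n (k - 1) \<le> (n - 0) choose (k - 1)"
      and G: "simplicial_complex G" and n: "card (verts G) = n" and nemb: "\<not> embeds F G"
      and "\<exists>M \<subseteq> edges G. pairwise disjnt M \<and> (\<forall>e\<in>M. card e = k) \<and> card M = card ?M0"
    then obtain M where M: "M \<subseteq> edges G" "pairwise disjnt M" "\<And>e. e \<in> M \<Longrightarrow> card e = k" "card M = card ?M0"
      by blast
    have finM: "finite M" using M(1) simplicial_complexD(2)[OF G] finite_subset by blast
    define E where "E = {B \<in> edges G. card B = k - 1 \<and> B \<inter> \<Union> M = {}}"
    have finE: "finite E" using simplicial_complexD(2)[OF G] by (simp add: E_def)
    obtain N where N: "N \<subseteq> E" "pairwise disjnt N" "\<And>e. e \<in> E \<Longrightarrow> e \<noteq> {} \<Longrightarrow> e \<inter> \<Union> N \<noteq> {}"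
      using maximal_disjoint_subfamily[OF finE] by metis
    have finN: "finite N" using N(1) finE finite_subset by blast
    have "card N < card S0"
    proof (rule ccontr)
      assume "\<not> card N < card S0"
      then obtain N' where N': "N' \<subseteq> N" "card N' = card S0" "finite N'"
        by (metis not_less obtain_subset_with_card_n)
      obtain f where f: "bij_betw f ?M0 M" using finite_same_card_bij[OF fin0(1) finM] M(4) by auto
      obtain g where g: "bij_betw g S0 N'" using finite_same_card_bij[OF fin0(2) N'(3)] N'(2) by auto
      \<comment> \<open>Each maximal edge gets a host edge of its own, in \<open>M\<close> or in
        \<open>N'\<close>; members of \<open>N'\<close> avoid \<open>M\<close>, so all targets are
        disjoint.\<close>
      define \<tau> where "\<tau> e = (if e \<in> ?M0 then f e else g e)" for e
      have \<tau>1: "\<tau> e \<in> M" if "e \<in> ?M0" for e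
        using that f by (auto simp: \<tau>_def bij_betw_def)
      have \<tau>2: "\<tau> e \<in> N'" if "e \<in> S0" for e
        using that g by (auto simp: \<tau>_def bij_betw_def S0_def)
      have MN: "disjnt X Y" if "X \<in> M" "Y \<in> N'" for X Y
        using that N'(1) N(1) by (auto simp: E_def disjnt_def)
      have dis: "disjnt (\<tau> e) (\<tau> e')" if e: "e \<in> maximal_edges F" "e' \<in> maximal_edges F" "e \<noteq> e'" for e e'
      proof -
        consider "e \<in> ?M0" "e' \<in> ?M0" | "e \<in> ?M0" "e' \<in> S0" | "e \<in> S0" "e' \<in> ?M0" | "e \<in> S0" "e' \<in> S0"
          using e split0 by blast
        then show ?thesis
        proof cases
          case 1
          then have "\<tau> e \<noteq> \<tau> e'" using bij_betw_imp_inj_on[OF f] e(3) by (simp add: \<tau>_def inj_on_eq_iff)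
          then show ?thesis using \<tau>1 1 M(2) by (auto simp: pairwise_def)
        next
          case 2
          then show ?thesis using MN \<tau>1 \<tau>2 by blast
        next
          case 3
          then show ?thesis using MN \<tau>1 \<tau>2 disjnt_sym by blast
        next
          case 4
          then have "\<tau> e \<noteq> \<tau> e'" using bij_betw_imp_inj_on[OF g] e(3) split0(2)
            by (auto simp: \<tau>_def inj_on_eq_iff)
          then show ?thesis using \<tau>2[OF 4(1)] \<tau>2[OF 4(2)] N'(1) N(2) by (auto simp: pairwise_def)
        qed
      qed
      have \<tau>G: "\<tau> e \<in> edges G" if "e \<in> maximal_edges F" for e
        using that \<tau>1[of e] \<tau>2[of e] split0(1) M(1) N'(1) N(1) unfolding E_def by blast
      have le: "card e \<le> card (\<tau> e)" if e: "e \<in> maximal_edges F" for e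
      proof (cases "e \<in> ?M0")
        case True
        then show ?thesis using \<tau>1 M(3) by (simp add: uniform_part_def)
      next
        case False
        then have "card e \<le> k" "card e \<noteq> k" "e \<in> S0"
          using e max_sub card_edge_le_dim[OF F] by (auto simp: uniform_part_def S0_def)
        moreover have "card (\<tau> e) = k - 1" using \<tau>2[OF \<open>e \<in> S0\<close>] N'(1) N(1) unfolding E_def by blast
        ultimately show ?thesis by simp
      qed
      obtain \<phi> where \<phi>: "inj_on \<phi> (\<Union>e\<in>maximal_edges F. e)" "\<And>e. e \<in> maximal_edges F \<Longrightarrow> \<phi> ` e \<subseteq> \<tau> e"
      proof (rule disjoint_family_embedding[of "maximal_edges F" "\<lambda>e. e" \<tau>])
        show "finite e" if "e \<in> maximal_edges F" for e
          using that max_sub simplicial_complexD(6)[OF F(1)] by blast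
        show "finite (\<tau> e)" if "e \<in> maximal_edges F" for e
          using that \<tau>G simplicial_complexD(6)[OF G] by blast
        show "disjoint_family_on (\<lambda>e. e) (maximal_edges F)"
          using disj unfolding disjoint_family_on_def pairwise_def disjnt_def by blast
        show "disjoint_family_on \<tau> (maximal_edges F)"
          using dis unfolding disjoint_family_on_def disjnt_def by blast
      qed (use le in auto)
      have "embeds F G"
        using \<phi> \<tau>G by (intro embedsI_maximal[OF F(1) G, of \<phi>]) (auto intro: simplicial_complexD(7)[OF G])
      then show False using nemb by blast
    qed
    define W where "W = \<Union> M \<union> \<Union> N"
    have "card W \<le> card (\<Union> M) + card (\<Union> N)" unfolding W_def by (rule card_Un_le)
    also have "\<dots> \<le> card M * k + card N * (k - 1)"
      using M(3) N(1) by (intro add_mono card_Union_uniform_le) (auto simp: E_def)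
    also have "\<dots> \<le> c" using \<open>card N < card S0\<close> M(4) by (simp add: c_def)
    finally have cW: "card W \<le> c" .
    have "W \<subseteq> verts G"
      using M(1) N(1) simplicial_complexD(5)[OF G] unfolding W_def E_def by blast
    then have finW: "finite W" using simplicial_complexD(1)[OF G] finite_subset by blast
    have near: "card (T - W) < k - 1" if T: "T \<in> edges G" for T
    proof (rule ccontr)
      assume "\<not> card (T - W) < k - 1"
      \<comment> \<open>\<open>R\<close> is a \<open>(k-1)\<close>-edge off \<open>M\<close> and
        disjoint from every member of \<open>N\<close>, against the maximality of
        \<open>N\<close>.\<close>
      then obtain R where R: "R \<subseteq> T - W" "card R = k - 1"
        by (metis not_less obtain_subset_with_card_n)
      then have "R \<in> E" using simplicial_complexD(7)[OF G T, of R] unfolding E_def W_def by auto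
      moreover have "R \<noteq> {}" using R(2) k by auto
      ultimately show False using N(3)[of R] R(1) unfolding W_def by blast
    qed
    have "card (edges G) \<le> card {T. T \<subseteq> verts G \<and> card (T - W) < k - 1}"
      using near simplicial_complexD(1,5)[OF G]
      by (intro card_mono) (auto intro: finite_subset[of _ "Pow (verts G)"])
    also have "\<dots> \<le> 2 ^ card W * binom_sum n (k - 1)"
      using card_near_subsets_le[OF simplicial_complexD(1)[OF G] finW] n by simp
    also have "\<dots> \<le> 2 ^ c * binom_sum n (k - 1)" using cW by simp
    \<comment> \<open>Order n^(k-2) against n^(k-1): a single summand of
      \<open>binom_sum n k\<close> is enough.\<close>
    also have "\<dots> \<le> n choose (k - 1)" using ev by simp
    also have "\<dots> \<le> binom_sum n k"
      unfolding binom_sum_def using k by (intro member_le_sum) auto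
    finally show "card (edges G) \<le> binom_sum n k" .
  qed
qed

lemma image_disjoint_family:
  assumes inj: "inj_on \<phi> V" and sub: "\<And>e. e \<in> M \<Longrightarrow> e \<subseteq> V" and disj: "pairwise disjnt M"
  shows "card ((`) \<phi> ` M) = card M" "pairwise disjnt ((`) \<phi> ` M)"
proof -
  have "inj_on ((`) \<phi>) M"
    using inj_on_image_eq_iff[OF inj] sub by (auto intro!: inj_onI)
  then show "card ((`) \<phi> ` M) = card M" by (rule card_image)
  show "pairwise disjnt ((`) \<phi> ` M)"
    unfolding pairwise_def
  proof (intro ballI impI)
    fix X Y assume "X \<in> (`) \<phi> ` M" "Y \<in> (`) \<phi> ` M" "X \<noteq> Y"
    then obtain e e' where e: "e \<in> M" "e' \<in> M" "X = \<phi> ` e" "Y = \<phi> ` e'" "e \<noteq> e'" by blast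
    then have "disjnt e e'" using disj by (auto simp: pairwise_def)
    then show "disjnt X Y"
      using e sub inj_on_image_Int[OF inj, of e e'] unfolding disjnt_def by auto
  qed
qed

lemma trivial_if_disjoint:
  fixes F :: "'a hypergraph"
  assumes k: "k \<ge> 2" and F: "simplicial_complex F" "complex_dim F = int k - 1"
    and disj: "pairwise disjnt (maximal_edges F)"
  shows "trivial_complex k F"
proof (rule trivial_complexI[OF k F], rule eventually_mono[OF disjoint_maximal_edges_bound[OF assms]],
    intro allI impI)
  fix n and G :: "nat hypergraph"
  let ?M0 = "edges (uniform_part F k)"
  assume bound: "\<forall>G :: nat hypergraph.
      simplicial_complex G \<longrightarrow> card (verts G) = n \<longrightarrow> \<not> embeds F G \<longrightarrow>
      (\<exists>M \<subseteq> edges G. pairwise disjnt M \<and> (\<forall>e\<in>M. card e = k) \<and> card M = card ?M0)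
      \<longrightarrow> card (edges G) \<le> binom_sum n k"
    and G: "simplicial_complex G" "card (verts G) = n" "\<not> embeds F G"
    and emb: "embeds (uniform_part F k) (uniform_part G k)"
  then obtain \<phi> where \<phi>: "inj_on \<phi> (verts F)" "\<And>e. e \<in> ?M0 \<Longrightarrow> \<phi> ` e \<in> edges (uniform_part G k)"
    unfolding embeds_def by (auto simp: uniform_part_def)
  have sub: "e \<subseteq> verts F" if "e \<in> ?M0" for e
    using that simplicial_complexD(5)[OF F(1)] by (auto simp: uniform_part_def)
  have M0: "?M0 \<subseteq> maximal_edges F" by (rule uniform_part_subset_maximal[OF F])
  have "pairwise disjnt ?M0" using disj M0 by (rule pairwise_subset)
  from image_disjoint_family[OF \<phi>(1) sub this]
  have "card ((`) \<phi> ` ?M0) = card ?M0" "pairwise disjnt ((`) \<phi> ` ?M0)" by blast+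
  moreover have "(`) \<phi> ` ?M0 \<subseteq> edges G" "\<forall>e\<in>(`) \<phi> ` ?M0. card e = k"
    using \<phi>(2) by (auto simp: uniform_part_def)
  ultimately have "\<exists>M \<subseteq> edges G. pairwise disjnt M \<and> (\<forall>e\<in>M. card e = k) \<and> card M = card ?M0"
    by (intro exI[of _ "(`) \<phi> ` ?M0"]) simp
  then show "card (edges G) \<le> binom_sum n k" using bound G by blast
qed

subsection \<open>Two maximal edges\<close>

locale free_complex =
  fixes F :: "'a hypergraph" and k :: nat and G :: "nat hypergraph" and n :: nat
  assumes k: "k \<ge> 2" and F: "simplicial_complex F"
    and G: "simplicial_complex G" and n: "card (verts G) = n" and free: "\<not> embeds F G"
begin

lemmas G_simps = simplicial_complexD[OF G]

definition large :: "nat set set" where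
  "large = {D \<in> edges G. k \<le> card D}"

definition missing :: "nat set set" where
  "missing = {B. B \<subseteq> verts G \<and> card B = k - 1 \<and> B \<notin> edges G}"

lemma finite_large: "finite large"
  unfolding large_def using G_simps(2) by simp

lemma finite_missing: "finite missing"
  unfolding missing_def using G_simps(1) by (auto intro: finite_subset[of _ "Pow (verts G)"])

lemma largeD:
  assumes "D \<in> large"
  shows "D \<in> edges G" "k \<le> card D" "D \<subseteq> verts G" "finite D" "\<And>A. A \<subseteq> D \<Longrightarrow> A \<in> edges G"
  using assms G_simps(5,6,7) unfolding large_def by auto

lemma card_edges_le: "card large \<le> card missing \<Longrightarrow> card (edges G) \<le> binom_sum n k"
  using edges_count_bound[OF G, of "k - 1" k] k n unfolding large_def missing_def by simp

lemma card_near_le: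
  assumes "P \<subseteq> large" "finite W" "card W \<le> c" "\<And>D. D \<in> P \<Longrightarrow> card (D - W) < m"
  shows "card P \<le> 2 ^ c * binom_sum n m"
proof -
  have "card P \<le> card {T. T \<subseteq> verts G \<and> card (T - W) < m}"
    using assms(1,4) largeD(3) G_simps(1)
    by (intro card_mono) (auto intro: finite_subset[of _ "Pow (verts G)"])
  also have "\<dots> \<le> 2 ^ card W * binom_sum n m"
    using card_near_subsets_le[OF G_simps(1) assms(2)] n by simp
  also have "\<dots> \<le> 2 ^ c * binom_sum n m" using assms(3) by simp
  finally show ?thesis .
qed

end

text \<open>What purity leaves of the case of two maximal edges: one of full size \<open>k\<close>
  and a smaller one.\<close>

locale two_maximal_edges = free_complex +
  fixes A0 B0 :: "'a set"
  assumes maximal: "maximal_edges F = {A0, B0}" and cA0: "card A0 = k" and cB0: "card B0 < k"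
begin

definition i where "i = card (A0 \<inter> B0)"

lemma fin0: "finite A0" "finite B0"
proof -
  have "{A0, B0} \<subseteq> edges F" unfolding maximal[symmetric] maximal_edges_def by blast
  then show "finite A0" "finite B0" using simplicial_complexD(6)[OF F] by auto
qed

lemma i_less: "i < card B0" "Suc i < k"
proof -
  have "\<not> B0 \<subseteq> A0"
  proof
    assume "B0 \<subseteq> A0"
    moreover have "B0 \<in> maximal_edges F" "A0 \<in> edges F"
      using maximal by (auto simp: maximal_edges_def)
    ultimately have "A0 = B0" by (simp add: maximal_edges_def)
    then show False using cA0 cB0 by simp
  qed
  then have "A0 \<inter> B0 \<subset> B0" by blast
  then show "i < card B0" unfolding i_def using fin0 by (intro psubset_card_mono)
  then show "Suc i < k" using cB0 by simp
qed

text \<open>\<open>B0\<close> has at most \<open>k - 1\<close> vertices, so a \<open>k\<close>-edge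
  and a \<open>(k-1)\<close>-edge meeting in exactly \<open>i\<close> vertices have room for each of
  the three cells \<open>A0 \<inter> B0\<close>, \<open>A0 - B0\<close> and
  \<open>B0 - A0\<close>.\<close>

lemma no_copy:
  assumes A: "A \<in> edges G" "card A = k" and B: "B \<in> edges G" "card B = k - 1" "card (A \<inter> B) = i"
  shows False
proof -
  define X where "X j = (if j = (0::nat) then A0 \<inter> B0 else if j = 1 then A0 - B0 else B0 - A0)" for j
  define Y where "Y j = (if j = (0::nat) then A \<inter> B else if j = 1 then A - B else B - A)" for j
  have fin: "finite A" "finite B" using A B G_simps(6) by auto
  have cX: "card (X 0) = i" "card (X 1) = k - i" "card (X 2) = card B0 - i"
    using fin0 cA0 card_Diff_subset_Int[of A0 B0] card_Diff_subset_Int[of B0 A0]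
    by (simp_all add: X_def i_def Int_commute)
  have cY: "card (Y 0) = i" "card (Y 1) = k - i" "card (Y 2) = k - 1 - i"
    using fin A B card_Diff_subset_Int[of A B] card_Diff_subset_Int[of B A]
    by (simp_all add: Y_def Int_commute)
  obtain \<phi> where \<phi>: "inj_on \<phi> (\<Union>j\<in>{0,1,2}. X j)" "\<And>j. j \<in> {0,1,2} \<Longrightarrow> \<phi> ` X j \<subseteq> Y j"
  proof (rule disjoint_family_embedding[of "{0,1,2}" X Y])
    show "disjoint_family_on X {0,1,2}" "disjoint_family_on Y {0,1,2}"
      by (auto simp: disjoint_family_on_def X_def Y_def)
    show "finite (X j)" "finite (Y j)" for j using fin0 fin by (auto simp: X_def Y_def)
    show "card (X j) \<le> card (Y j)" if "j \<in> {0,1,2}" for j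
      using that cX cY cB0 by auto
  qed blast
  have "\<phi> ` (A0 \<inter> B0) \<subseteq> A \<inter> B" "\<phi> ` (A0 - B0) \<subseteq> A - B" "\<phi> ` (B0 - A0) \<subseteq> B - A"
    using \<phi>(2)[of 0] \<phi>(2)[of 1] \<phi>(2)[of 2] by (simp_all add: X_def Y_def)
  then have "\<phi> ` A0 \<subseteq> A" "\<phi> ` B0 \<subseteq> B" by blast+
  moreover have "(\<Union>j\<in>{0,1,2}. X j) = A0 \<union> B0" by (auto simp: X_def)
  ultimately have "embeds F G"
    using \<phi>(1) maximal A(1) B(1) G_simps(7)
    by (intro embedsI_maximal[OF F G, of \<phi>]) auto
  then show False using free by contradiction
qed

text \<open>Since \<open>i < k\<close>, the set \<open>B \<inter> D\<close> extends to
  \<open>k\<close> vertices inside \<open>D\<close>, and the resulting \<open>k\<close>-edge meets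
  \<open>B\<close> in nothing more.\<close>

lemma no_copy_large:
  assumes D: "D \<in> large" and B: "B \<in> edges G" "card B = k - 1" "card (B \<inter> D) = i"
  shows False
proof -
  obtain A where A: "B \<inter> D \<subseteq> A" "A \<subseteq> D" "card A = k"
    using obtain_subset_between[of "B \<inter> D" D k] largeD[OF D] B(3) i_less by auto
  then have "A \<inter> B = B \<inter> D" by blast
  then show False using no_copy[of A B] A(2,3) largeD(5)[OF D A(2)] B by simp
qed

text \<open>An edge with \<open>2 * k\<close> vertices has room for a \<open>k\<close>-set and a
  \<open>(k-1)\<close>-set meeting in exactly \<open>i\<close> vertices, hence for a copy of
  \<open>F\<close>.\<close>

lemma card_large_less: "card D < 2 * k" if D: "D \<in> large"
proof (rule ccontr)
  assume "\<not> card D < 2 * k"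
  then have "k - 1 \<le> card D" by simp
  then obtain B where B: "B \<subseteq> D" "card B = k - 1"
    by (metis obtain_subset_with_card_n)
  have "i \<le> card B" using B(2) i_less by simp
  then obtain I where I: "I \<subseteq> B" "card I = i"
    by (metis obtain_subset_with_card_n)
  have finB: "finite B" using finite_subset[OF B(1) largeD(4)[OF D]] .
  have finI: "finite I" using finite_subset[OF I(1) finB] .
  note finD = finB finI
  have "card (I \<union> (D - B)) = i + (card D - (k - 1))"
    using I B finD largeD(4)[OF D] by (subst card_Un_disjoint) (auto simp: card_Diff_subset)
  then have "k \<le> card (I \<union> (D - B))" using \<open>\<not> card D < 2 * k\<close> by simp
  then obtain A where A: "I \<subseteq> A" "A \<subseteq> I \<union> (D - B)" "card A = k"
    using obtain_subset_between[of I "I \<union> (D - B)" k] finD largeD(4)[OF D] I(2) i_less by auto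
  have "A \<inter> B = I" using A I by blast
  moreover have "A \<subseteq> D" using A I B by blast
  ultimately show False using no_copy[of A B] A B I largeD(5)[OF D] by simp
qed

text \<open>Otherwise \<open>i\<close> common vertices and \<open>k - 1 - i\<close> vertices of
  \<open>D'\<close> off \<open>D\<close> form a \<open>(k-1)\<close>-edge meeting \<open>D\<close>
  in exactly \<open>i\<close> vertices.\<close>

lemma card_Diff_large:
  assumes D: "D \<in> large" "D' \<in> large" and le: "i \<le> card (D \<inter> D')"
  shows "card (D' - D) < k - 1 - i"
proof (rule ccontr)
  assume "\<not> card (D' - D) < k - 1 - i"
  then obtain R where R: "R \<subseteq> D' - D" "card R = k - 1 - i"
    by (metis not_less obtain_subset_with_card_n)
  obtain I where I: "I \<subseteq> D \<inter> D'" "card I = i"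
    using le by (metis obtain_subset_with_card_n)
  have fin: "finite I" "finite R"
    using I(1) R(1) by (auto intro: finite_subset[OF _ largeD(4)[OF D(2)]])
  have "card (I \<union> R) = k - 1"
    using I R fin i_less by (subst card_Un_disjoint) auto
  moreover have "(I \<union> R) \<inter> D = I" using I R by blast
  moreover have "I \<union> R \<subseteq> D'" using I R by blast
  ultimately show False using no_copy_large[OF D(1), of "I \<union> R"] largeD(5)[OF D(2)] I(2) by simp
qed

text \<open>The exponent \<open>3 * k\<close> is made of \<open>k\<close> for the subsets of a
  missing set \<open>B\<close> that may serve as \<open>B \<inter> D\<close>, and
  \<open>2 * k\<close> for the traces on one fixed large edge.\<close>

lemma bound:
  assumes ev: "2 ^ (3 * k) * binom_sum n (k - 1 - i) \<le> (n - 2 * k) choose (k - 1 - i)"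
  shows "card (edges G) \<le> binom_sum n k"
proof (rule card_edges_le)
  show "card large \<le> card missing"
  proof (rule double_counting_card_le[where R = "\<lambda>D B. card (B \<inter> D) = i"])
    show "finite large" "finite missing" by (rule finite_large finite_missing)+
    show "(n - 2 * k) choose (k - 1 - i) \<le> card {B \<in> missing. card (B \<inter> D) = i}" if D: "D \<in> large" for D
    proof -
      \<comment> \<open>One \<open>i\<close>-subset of \<open>D\<close> is kept fixed; every choice
        of the other vertices off \<open>D\<close> then gives a missing set.\<close>
      have "i \<le> card D" using largeD(2)[OF D] i_less by simp
      then obtain I where I: "I \<subseteq> D" "card I = i"
        by (metis obtain_subset_with_card_n)
      have finI: "finite I" using finite_subset[OF I(1) largeD(4)[OF D]] .
      let ?R = "{R. R \<subseteq> verts G - D \<and> card R = k - 1 - i}"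
      have finR: "finite R" if "R \<in> ?R" for R using that G_simps(1) finite_subset by blast
      have "card ?R \<le> card {B \<in> missing. card (B \<inter> D) = i}"
      proof (rule card_inj_on_le[where f = "\<lambda>R. I \<union> R"])
        show "inj_on (\<lambda>R. I \<union> R) ?R" using I by (intro inj_onI) blast
        show "(\<lambda>R. I \<union> R) ` ?R \<subseteq> {B \<in> missing. card (B \<inter> D) = i}"
        proof
          fix B assume "B \<in> (\<lambda>R. I \<union> R) ` ?R"
          then obtain R where R: "R \<in> ?R" "B = I \<union> R" by blast
          have "card B = k - 1"
            unfolding R(2) using I R(1) finI finR[OF R(1)] i_less by (subst card_Un_disjoint) auto
          moreover have "B \<inter> D = I" using R I by blast
          moreover have "B \<subseteq> verts G" using R I largeD(3)[OF D] by blast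
          ultimately show "B \<in> {B \<in> missing. card (B \<inter> D) = i}"
            using no_copy_large[OF D, of B] I(2) by (auto simp: missing_def)
        qed
      qed (use finite_missing in simp)
      moreover have "card ?R = (n - card D) choose (k - 1 - i)"
        using G_simps(1) n largeD(3,4)[OF D] by (simp add: n_subsets card_Diff_subset)
      moreover have "(n - 2 * k) choose (k - 1 - i) \<le> (n - card D) choose (k - 1 - i)"
        using card_large_less[OF D] by (intro binomial_right_mono) simp
      ultimately show ?thesis by linarith
    qed
    show "card {D \<in> large. card (B \<inter> D) = i} \<le> 2 ^ (3 * k) * binom_sum n (k - 1 - i)" if B: "B \<in> missing" for B
    proof -
      have finB: "finite B" using B G_simps(1) finite_subset unfolding missing_def by blast
      let ?I = "{I. I \<subseteq> B \<and> card I = i}"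
      have finI: "finite ?I" using finB by (auto intro: finite_subset[of _ "Pow B"])
      have "card ?I \<le> card (Pow B)" using finB by (intro card_mono) auto
      also have "\<dots> = 2 ^ (k - 1)" using B finB by (simp add: card_Pow missing_def)
      also have "\<dots> \<le> 2 ^ k" by simp
      finally have cI: "card ?I \<le> 2 ^ k" .
      \<comment> \<open>Large edges through \<open>I\<close> share \<open>i\<close> vertices with
        any one of them, \<open>D0\<close>, so they have fewer than \<open>k - 1 - i\<close>
        vertices off \<open>D0\<close>.\<close>
      have link: "card {D \<in> large. I \<subseteq> D} \<le> 2 ^ (2 * k) * binom_sum n (k - 1 - i)" if I: "I \<in> ?I" for I
      proof (cases "{D \<in> large. I \<subseteq> D} = {}")
        case True
        then show ?thesis by (metis card.empty zero_le)
      next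
        case False
        then obtain D0 where D0: "D0 \<in> large" "I \<subseteq> D0" by blast
        show ?thesis
        proof (rule card_near_le[where W = D0])
          show "finite D0" "card D0 \<le> 2 * k"
            using largeD(4)[OF D0(1)] card_large_less[OF D0(1)] by auto
          fix D assume D: "D \<in> {D \<in> large. I \<subseteq> D}"
          have "i \<le> card (D0 \<inter> D)"
            using I D D0 card_mono[of "D0 \<inter> D" I] largeD(4)[OF D0(1)] by auto
          then show "card (D - D0) < k - 1 - i" using card_Diff_large D0(1) D by blast
        qed blast
      qed
      have "{D \<in> large. card (B \<inter> D) = i} \<subseteq> (\<Union>I\<in>?I. {D \<in> large. I \<subseteq> D})" by blast
      then have "card {D \<in> large. card (B \<inter> D) = i} \<le> card (\<Union>I\<in>?I. {D \<in> large. I \<subseteq> D})"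
        using finI finite_large by (intro card_mono) auto
      also have "\<dots> \<le> (\<Sum>I\<in>?I. card {D \<in> large. I \<subseteq> D})" using finI by (rule card_UN_le)
      also have "\<dots> \<le> card ?I * (2 ^ (2 * k) * binom_sum n (k - 1 - i))"
        using sum_bounded_above[of ?I "\<lambda>I. card {D \<in> large. I \<subseteq> D}"] link by simp
      also have "\<dots> \<le> 2 ^ k * (2 ^ (2 * k) * binom_sum n (k - 1 - i))" using cI by (rule mult_le_mono1)
      also have "\<dots> = 2 ^ (3 * k) * binom_sum n (k - 1 - i)"
        by (simp add: mult.assoc[symmetric] power_add[symmetric])
      finally show ?thesis .
    qed
    \<comment> \<open>The summand for \<open>r = 0\<close> makes the left side of \<open>ev\<close>
      positive, hence also the right side.\<close>
    have "binom_sum n (k - 1 - i) \<ge> n choose 0"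
      unfolding binom_sum_def using i_less by (intro member_le_sum) auto
    then show "0 < (n - 2 * k) choose (k - 1 - i)" using ev
      by (metis One_nat_def binomial_n_0 le_eq_less_or_eq less_le_trans mult_pos_pos nat_zero_less_power_iff zero_less_numeral zero_less_one)
  qed (rule ev)
qed

end

text \<open>Unless \<open>F\<close> is pure, there are a \<open>k\<close>-edge and a maximal edge
  with fewer vertices, and these two exhaust the maximal edges.\<close>

lemma trivial_if_two_maximal_edges:
  fixes F :: "'a hypergraph"
  assumes k: "k \<ge> 2" and F: "simplicial_complex F" "complex_dim F = int k - 1"
    and two: "card (maximal_edges F) \<le> 2"
  shows "trivial_complex k F"
proof (cases "maximal_edges F = edges (uniform_part F k)")
  case True
  then show ?thesis by (rule trivial_if_pure[OF k F])
next
  case False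
  have sub: "edges (uniform_part F k) \<subseteq> maximal_edges F" by (rule uniform_part_subset_maximal[OF F])
  obtain A0 where "A0 \<in> edges F" and cA: "card A0 = k" by (rule exists_edge_card_dim[OF F])
  then have A0: "A0 \<in> maximal_edges F" using sub by (auto simp: uniform_part_def)
  obtain B0 where B0: "B0 \<in> maximal_edges F" "B0 \<notin> edges (uniform_part F k)" using False sub by blast
  then have "B0 \<in> edges F" "card B0 \<noteq> k" by (auto simp: uniform_part_def maximal_edges_def)
  then have cB: "card B0 < k" "A0 \<noteq> B0" using card_edge_le_dim[OF F, of B0] cA by auto
  have "finite (maximal_edges F)"
    using simplicial_complexD(2)[OF F(1)] by (auto simp: maximal_edges_def)
  then have "{A0, B0} = maximal_edges F"
    using A0 B0 two cB(2) by (intro card_seteq) auto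
  then have maximal: "maximal_edges F = {A0, B0}" ..
  let ?p = "k - 1 - card (A0 \<inter> B0)"
  show ?thesis
  proof (rule trivial_complexI[OF k F],
      rule eventually_mono[OF eventually_binom_sum_le_binomial[of "2 ^ (3 * k)" ?p "2 * k"]], intro allI impI)
    fix n and G :: "nat hypergraph"
    assume ev: "2 ^ (3 * k) * binom_sum n ?p \<le> (n - 2 * k) choose ?p"
      and G: "simplicial_complex G" "card (verts G) = n" "\<not> embeds F G"
    interpret two_maximal_edges F k G n A0 B0
      by unfold_locales (use k F G maximal cA cB in auto)
    show "card (edges G) \<le> binom_sum n k" by (rule bound) (use ev in \<open>simp add: i_def\<close>)
  qed
qed

subsection \<open>The exceptional configuration with three maximal edges\<close>

locale three_maximal_edges = free_complex +
  fixes A0 C0 :: "'a set" and a0 b0 :: 'a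
  assumes maximal: "maximal_edges F = {A0, insert a0 C0, insert b0 C0}"
    and k3: "k \<ge> 3" and cA0: "card A0 = k" and cC0: "card C0 = k - 2"
    and ab: "a0 \<in> A0" "b0 \<in> A0" "a0 \<noteq> b0" and disj0: "A0 \<inter> C0 = {}"
begin

lemma fin0: "finite A0" "finite C0"
  using cA0 cC0 k3 by (auto intro: card_ge_0_finite)

text \<open>The cells are \<open>{a0}\<close>, \<open>{b0}\<close>, the rest of \<open>A0\<close>,
  and \<open>C0\<close>; singling out the two vertices makes the smaller edges attach to
  \<open>A\<close> where they should.\<close>

lemma no_copy:
  assumes A: "A \<in> edges G" "card A = k" "x \<in> A" "y \<in> A" "x \<noteq> y"
    and C: "card C = k - 2" "C \<inter> A = {}" "insert x C \<in> edges G" "insert y C \<in> edges G"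
  shows False
proof -
  define X where "X j = (if j = (0::nat) then {a0} else if j = 1 then {b0} else if j = 2 then A0 - {a0, b0} else C0)" for j
  define Y where "Y j = (if j = (0::nat) then {x} else if j = 1 then {y} else if j = 2 then A - {x, y} else C)" for j
  have fin: "finite A" "finite C" using G_simps(6)[OF A(1)] G_simps(6)[OF C(3)] by auto
  have c2: "card (A0 - {a0, b0}) = k - 2" "card (A - {x, y}) = k - 2"
    using fin fin0 ab A cA0 by (auto simp: card_Diff_subset)
  obtain \<phi> where \<phi>: "inj_on \<phi> (\<Union>j\<in>{0,1,2,3}. X j)" "\<And>j. j \<in> {0,1,2,3} \<Longrightarrow> \<phi> ` X j \<subseteq> Y j"
  proof (rule disjoint_family_embedding[of "{0,1,2,3}" X Y])
    show "disjoint_family_on X {0,1,2,3}" "disjoint_family_on Y {0,1,2,3}"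
      using ab A C disj0 by (auto simp: disjoint_family_on_def X_def Y_def)
    show "finite (X j)" "finite (Y j)" for j using fin0 fin by (auto simp: X_def Y_def)
    show "card (X j) \<le> card (Y j)" if "j \<in> {0,1,2,3}" for j
      using that c2 cC0 C(1) by (auto simp: X_def Y_def)
  qed blast
  have img: "\<phi> ` {a0} \<subseteq> {x}" "\<phi> ` {b0} \<subseteq> {y}" "\<phi> ` (A0 - {a0, b0}) \<subseteq> A - {x, y}" "\<phi> ` C0 \<subseteq> C"
    using \<phi>(2)[of 0] \<phi>(2)[of 1] \<phi>(2)[of 2] \<phi>(2)[of 3] by (simp_all add: X_def Y_def)
  have "A0 = {a0} \<union> {b0} \<union> (A0 - {a0, b0})" using ab by blast
  then have "\<phi> ` A0 = \<phi> ` {a0} \<union> \<phi> ` {b0} \<union> \<phi> ` (A0 - {a0, b0})" by (metis image_Un)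
  then have "\<phi> ` A0 \<subseteq> A" using img(1,2,3) A(3,4) by auto
  moreover have "\<phi> ` insert a0 C0 \<subseteq> insert x C" "\<phi> ` insert b0 C0 \<subseteq> insert y C"
    using img(1,2,4) by auto
  ultimately have "\<phi> ` e \<in> edges G" if "e \<in> maximal_edges F" for e
    using that G_simps(7)[OF A(1)] G_simps(7)[OF C(3)] G_simps(7)[OF C(4)] unfolding maximal by auto
  moreover have "(\<Union>j\<in>{0,1,2,3}. X j) = \<Union> (maximal_edges F)" using ab by (auto simp: X_def maximal)
  ultimately have "embeds F G"
    using \<phi>(1) by (intro embedsI_maximal[OF F G, of \<phi>]) auto
  then show False using free by contradiction
qed

text \<open>\<open>C\<close> avoids all of \<open>D\<close>, so any \<open>k\<close>-subset of
  \<open>D\<close> through \<open>x\<close> and \<open>y\<close> can serve as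
  \<open>A\<close>.\<close>

lemma no_copy_large:
  assumes D: "D \<in> large" "x \<in> D" "y \<in> D" "x \<noteq> y"
    and C: "card C = k - 2" "C \<inter> D = {}" "insert x C \<in> edges G" "insert y C \<in> edges G"
  shows False
proof -
  obtain A where A: "{x, y} \<subseteq> A" "A \<subseteq> D" "card A = k"
    using obtain_subset_between[of "{x, y}" D k] largeD[OF D(1)] D k by auto
  then show False
    using no_copy[of A x y C] D C largeD(5)[OF D(1) A(2)] by blast
qed

text \<open>Beside a \<open>k\<close>-subset of an edge with \<open>2 * k\<close> vertices there
  remain \<open>k - 2\<close> vertices for \<open>C\<close>, so this edge alone would contain the
  configuration.\<close>

lemma card_large_less: "card D < 2 * k" if D: "D \<in> large"
proof (rule ccontr)
  assume "\<not> card D < 2 * k"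
  then have D2: "2 * k \<le> card D" by simp
  obtain B where B: "B \<subseteq> D" "card B = 2"
    using largeD(2)[OF D] k by (metis le_trans obtain_subset_with_card_n)
  then obtain x y where xy: "x \<in> D" "y \<in> D" "x \<noteq> y" by (auto simp: card_2_iff)
  obtain A where A: "{x, y} \<subseteq> A" "A \<subseteq> D" "card A = k"
    using obtain_subset_between[of "{x, y}" D k] largeD[OF D] xy k by auto
  have "finite A" using finite_subset[OF A(2) largeD(4)[OF D]] .
  then have "card (D - A) = card D - k" using A by (simp add: card_Diff_subset)
  then have "k - 2 \<le> card (D - A)" using D2 by simp
  then obtain C where C: "C \<subseteq> D - A" "card C = k - 2" by (metis obtain_subset_with_card_n)
  have "insert x C \<subseteq> D" "insert y C \<subseteq> D" using C xy by blast+
  then have "insert x C \<in> edges G" "insert y C \<in> edges G" using largeD(5)[OF D] by blast+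
  moreover have "C \<inter> A = {}" using C by blast
  ultimately show False
    using no_copy[of A x y C] A C xy largeD(5)[OF D A(2)] by blast
qed

text \<open>With \<open>k - 2\<close> vertices of \<open>D'\<close> off \<open>D\<close> as
  \<open>C\<close>, two common vertices \<open>x\<close> and \<open>y\<close> would complete the
  configuration.\<close>

lemma card_Diff_large:
  assumes D: "D \<in> large" "D' \<in> large" and xy: "x \<in> D \<inter> D'" "y \<in> D \<inter> D'" "x \<noteq> y"
  shows "card (D' - D) < k - 2"
proof (rule ccontr)
  assume "\<not> card (D' - D) < k - 2"
  then obtain C where C: "C \<subseteq> D' - D" "card C = k - 2"
    by (metis not_less obtain_subset_with_card_n)
  have "insert x C \<subseteq> D'" "insert y C \<subseteq> D'" using C xy by blast+
  then have "insert x C \<in> edges G" "insert y C \<in> edges G" using largeD(5)[OF D(2)] by blast+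
  moreover have "C \<inter> D = {}" using C by blast
  ultimately show False
    using no_copy_large[OF D(1), of x y C] C xy by blast
qed

text \<open>\<open>D'\<close> has at least \<open>k\<close> vertices and at most
  \<open>k - 3\<close> of them lie off \<open>D\<close>, so three are common. This makes the sets
  \<open>D - {x, y}\<close> intersecting.\<close>

lemma card_Int_large:
  assumes D: "D \<in> large" "D' \<in> large" and xy: "x \<in> D \<inter> D'" "y \<in> D \<inter> D'" "x \<noteq> y"
  obtains z where "z \<in> D \<inter> D'" "z \<noteq> x" "z \<noteq> y"
proof -
  have "card (D' - D) < k - 2" using assms by (rule card_Diff_large)
  moreover have "card D' = card (D \<inter> D') + card (D' - D)"
    using largeD(4)[OF D(2)] by (metis Int_commute card_Int_Diff)
  ultimately have "2 < card (D \<inter> D')" using largeD(2)[OF D(2)] by linarith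
  moreover have "card {x, y} = 2" using xy(3) by simp
  ultimately have "\<not> D \<inter> D' \<subseteq> {x, y}"
    by (metis card_mono finite.emptyI finite.insertI not_less)
  then show ?thesis using that by blast
qed

text \<open>A spare vertex in \<open>D\<close> lets \<open>A\<close> omit a third common vertex
  \<open>z\<close>, which then joins \<open>C\<close>, so that \<open>k - 3\<close> vertices off
  \<open>D\<close> suffice. This saves one order of magnitude.\<close>

lemma card_Diff_larger:
  assumes D: "D \<in> large" "D' \<in> large" and xy: "x \<in> D \<inter> D'" "y \<in> D \<inter> D'" "x \<noteq> y"
    and big: "k < card D"
  shows "card (D' - D) < k - 3"
proof (rule ccontr)
  assume "\<not> card (D' - D) < k - 3"
  then obtain R where R: "R \<subseteq> D' - D" "card R = k - 3"
    by (metis not_less obtain_subset_with_card_n)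
  obtain z where z: "z \<in> D \<inter> D'" "z \<noteq> x" "z \<noteq> y" by (rule card_Int_large[OF D xy])
  have finR: "finite R"
    using R(1) by (auto intro: finite_subset[OF _ largeD(4)[OF D(2)]])
  have "card (D - {z}) = card D - 1" using z by simp
  then have "k \<le> card (D - {z})" using big by simp
  moreover have "{x, y} \<subseteq> D - {z}" "finite (D - {z})" "card {x, y} \<le> k"
    using xy z largeD(4)[OF D(1)] k by auto
  ultimately obtain A where A: "{x, y} \<subseteq> A" "A \<subseteq> D - {z}" "card A = k"
    using obtain_subset_between[of "{x, y}" "D - {z}" k] by metis
  have "card (insert z R) = k - 2" using R z finR k3 by (subst card_insert_disjoint) auto
  moreover have "insert z R \<inter> A = {}" using A R by blast
  moreover have "insert x (insert z R) \<subseteq> D'" "insert y (insert z R) \<subseteq> D'" using R z xy by blast+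
  moreover have "A \<in> edges G" using A(2) largeD(5)[OF D(1)] by blast
  ultimately show False
    using no_copy[of A x y "insert z R"] A xy(3) largeD(5)[OF D(2)] by blast
qed

text \<open>The sets \<open>D - {x, y}\<close> form an intersecting family. If all of them share a vertex, the main
  term counts them; otherwise each of them meets a bounded set in two vertices.\<close>
lemma card_pair_degree:
  assumes xy: "x \<noteq> y"
  defines "P \<equiv> {D \<in> large. x \<in> D \<and> y \<in> D}"
  shows "card P \<le> (n choose (k - 3)) + 2 ^ (2 * k + k * k) * binom_sum n (k - 3)"
proof -
  have PD: "D \<in> large" "x \<in> D" "y \<in> D" if "D \<in> P" for D using that by (auto simp: P_def)
  have PL: "P \<subseteq> large" by (auto simp: P_def)
  have finP: "finite P" using finite_subset[OF PL finite_large] .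
  consider (big) D0 where "D0 \<in> P" "k < card D0"
    | (star) z where "\<forall>D\<in>P. card D = k" "z \<noteq> x" "z \<noteq> y" "\<forall>D\<in>P. z \<in> D"
    | (empty) "P = {}"
    | (nontrivial) D0 where "D0 \<in> P" "\<forall>D\<in>P. card D = k" "\<forall>z. z \<noteq> x \<longrightarrow> z \<noteq> y \<longrightarrow> (\<exists>D\<in>P. z \<notin> D)"
  proof -
    have "card D = k" if "D \<in> P" "\<not> k < card D" for D
      using that largeD(2)[OF PD(1)[OF that(1)]] by simp
    then show thesis using big star empty nontrivial by (metis all_not_in_conv)
  qed
  then show ?thesis
  proof cases
    case big
    have "card P \<le> 2 ^ (2 * k + k * k) * binom_sum n (k - 3)"
    proof (rule card_near_le[OF PL, of D0])
      show "finite D0" by (rule largeD(4)[OF PD(1)[OF big(1)]])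
      \<comment> \<open>The bound covers both this case, with fewer than \<open>2 * k\<close>
        vertices, and the set \<open>W\<close> of the last case, with at most
        \<open>k + k * k\<close>.\<close>
      show "card D0 \<le> 2 * k + k * k" using card_large_less[OF PD(1)[OF big(1)]] by simp
      show "card (D - D0) < k - 3" if "D \<in> P" for D
        using card_Diff_larger[of D0 D x y] PD[OF that] PD[OF big(1)] xy big(2) by simp
    qed
    then show ?thesis by simp
  next
    case star
    have "card P \<le> card {T. T \<subseteq> verts G \<and> card T = k - 3}"
    proof (rule card_inj_on_le[where f = "\<lambda>D. D - {x, y, z}"])
      show "inj_on (\<lambda>D. D - {x, y, z}) P"
      proof (rule inj_onI)
        fix D D' assume "D \<in> P" "D' \<in> P" "D - {x, y, z} = D' - {x, y, z}"
        moreover have "{x, y, z} \<subseteq> D" "{x, y, z} \<subseteq> D'" using calculation PD star(4) by auto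
        ultimately show "D = D'" by blast
      qed
      show "(\<lambda>D. D - {x, y, z}) ` P \<subseteq> {T. T \<subseteq> verts G \<and> card T = k - 3}"
      proof
        fix T assume "T \<in> (\<lambda>D. D - {x, y, z}) ` P"
        then obtain D where D: "D \<in> P" "T = D - {x, y, z}" by blast
        have "{x, y, z} \<subseteq> D" using D PD star(4) by auto
        moreover have "card {x, y, z} = 3" using star(2,3) xy by auto
        ultimately have "card T = k - 3" using D star(1) by (simp add: card_Diff_subset)
        then show "T \<in> {T. T \<subseteq> verts G \<and> card T = k - 3}" using D largeD(3)[OF PD(1)[OF D(1)]] by auto
      qed
      show "finite {T. T \<subseteq> verts G \<and> card T = k - 3}"
        using G_simps(1) by (auto intro: finite_subset[of _ "Pow (verts G)"])
    qed
    also have "\<dots> = n choose (k - 3)" using G_simps(1) n by (simp add: n_subsets)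
    finally show ?thesis by simp
  next
    case empty
    then show ?thesis by simp
  next
    case nontrivial
    define f where "f z = (SOME D. D \<in> P \<and> z \<notin> D)" for z
    have f: "f z \<in> P" "z \<notin> f z" if "z \<noteq> x" "z \<noteq> y" for z
      using someI_ex[of "\<lambda>D. D \<in> P \<and> z \<notin> D"] nontrivial(3) that unfolding f_def by blast+
    \<comment> \<open>An edge in \<open>P\<close> meets \<open>D0\<close> in some \<open>z\<close>
      other than \<open>x\<close> and \<open>y\<close>, and then meets the member
      \<open>f z\<close>, which misses \<open>z\<close>, in a further vertex: four of its vertices
      lie in \<open>W\<close>.\<close>
    define W where "W = D0 \<union> (\<Union>z\<in>D0 - {x, y}. f z)"
    have finD: "finite D" if "D \<in> P" for D using largeD(4)[OF PD(1)[OF that]] .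
    have cD: "card D = k" if "D \<in> P" for D using that nontrivial(2) by blast
    have "card (\<Union>z\<in>D0 - {x, y}. f z) \<le> card (f ` (D0 - {x, y})) * k"
      using cD f by (intro card_Union_uniform_le) auto
    also have "\<dots> \<le> k * k"
    proof (rule mult_le_mono1)
      have "card (f ` (D0 - {x, y})) \<le> card (D0 - {x, y})"
        using finD[OF nontrivial(1)] by (intro card_image_le) simp
      also have "\<dots> \<le> card D0" using finD[OF nontrivial(1)] by (intro card_mono) auto
      finally show "card (f ` (D0 - {x, y})) \<le> k" using cD[OF nontrivial(1)] by simp
    qed
    finally have "card W \<le> k + k * k"
      using card_Un_le[of D0 "\<Union>z\<in>D0 - {x, y}. f z"] cD[OF nontrivial(1)] unfolding W_def by linarith
    then have cW: "card W \<le> 2 * k + k * k" by simp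
    have finW: "finite W" unfolding W_def using finD f nontrivial(1) by auto
    have "card P \<le> 2 ^ (2 * k + k * k) * binom_sum n (k - 3)"
    proof (rule card_near_le[OF PL finW cW])
      fix D assume D: "D \<in> P"
      obtain z where z: "z \<in> D0 \<inter> D" "z \<noteq> x" "z \<noteq> y"
        using card_Int_large[of D0 D x y] PD[OF D] PD[OF nontrivial(1)] xy by blast
      obtain z' where z': "z' \<in> f z \<inter> D" "z' \<noteq> x" "z' \<noteq> y"
        using card_Int_large[of "f z" D x y] PD[OF D] PD[OF f(1)[OF z(2,3)]] xy by blast
      have "z' \<noteq> z" using z' f(2)[OF z(2,3)] by blast
      then have c4: "card {x, y, z, z'} = 4" using xy z z' by auto
      have sub: "{x, y, z, z'} \<subseteq> D" using PD[OF D] z z' by blast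
      have "{x, y, z, z'} \<subseteq> W" unfolding W_def using PD[OF nontrivial(1)] z z' by blast
      then have "card (D - W) \<le> card (D - {x, y, z, z'})"
        using finD[OF D] by (intro card_mono) auto
      also have "\<dots> = k - 4" using sub c4 cD[OF D] by (simp add: card_Diff_subset)
      finally have "card (D - W) \<le> k - 4" .
      \<comment> \<open>Subtraction is truncated, so \<open>k - 4 < k - 3\<close> requires
        this.\<close>
      moreover have "4 \<le> k" using card_mono[OF finD[OF D] sub] c4 cD[OF D] by simp
      ultimately show "card (D - W) < k - 3" by simp
    qed
    then show ?thesis by simp
  qed
qed

text \<open>Count pairs of an edge through \<open>x\<close> and another vertex of it, at least
  \<open>k - 1\<close> per edge. Dividing by \<open>k - 1\<close>, where \<open>k - 2\<close> would
  only tie asymptotically, leaves the margin that \<open>ev\<close> exploits.\<close>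

lemma card_vertex_degree:
  assumes ev: "n * ((n choose (k - 3)) + 2 ^ (2 * k + k * k) * binom_sum n (k - 3))
      \<le> (k - 3 + 2) * ((n - 2 * k) choose Suc (k - 3))"
  shows "card {D \<in> large. x \<in> D} \<le> (n - 2 * k) choose (k - 2)"
proof -
  let ?d = "(n choose (k - 3)) + 2 ^ (2 * k + k * k) * binom_sum n (k - 3)"
  have "card {D \<in> large. x \<in> D} * (k - 1) \<le> card (verts G - {x}) * ?d"
  proof (rule double_counting[where R = "\<lambda>D y. y \<in> D"])
    show "finite {D \<in> large. x \<in> D}" using finite_large by simp
    show "finite (verts G - {x})" using G_simps(1) by simp
    fix D assume D: "D \<in> {D \<in> large. x \<in> D}"
    then have "{y \<in> verts G - {x}. y \<in> D} = D - {x}" using largeD(3) by blast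
    then show "k - 1 \<le> card {y \<in> verts G - {x}. y \<in> D}" using D largeD(2)[of D] by simp
  next
    fix y assume "y \<in> verts G - {x}"
    then show "card {D \<in> {D \<in> large. x \<in> D}. y \<in> D} \<le> ?d"
      using card_pair_degree[of x y] by (simp add: conj_assoc)
  qed
  also have "\<dots> \<le> n * ?d"
    using n G_simps(1) by (intro mult_le_mono1) (metis card_Diff1_le)
  also have "\<dots> \<le> (k - 1) * ((n - 2 * k) choose (k - 2))"
  proof -
    have "k - 3 + 2 = k - 1" "Suc (k - 3) = k - 2" using k3 by auto
    then show ?thesis using ev by metis
  qed
  finally show ?thesis using k by simp
qed

text \<open>For a \<open>(k-2)\<close>-set \<open>C\<close> off \<open>D\<close>, at most one
  \<open>x\<close> in \<open>D\<close> makes \<open>insert x C\<close> an edge, so at least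
  \<open>k - 1\<close> of these sets are missing. A missing set in turn has \<open>k - 1\<close>
  vertices, each of bounded degree; the two factors \<open>k - 1\<close> balance.\<close>

lemma bound:
  assumes ev: "n * ((n choose (k - 3)) + 2 ^ (2 * k + k * k) * binom_sum n (k - 3))
      \<le> (k - 3 + 2) * ((n - 2 * k) choose Suc (k - 3))" and n3: "n \<ge> 3 * k"
  shows "card (edges G) \<le> binom_sum n k"
proof (rule card_edges_le)
  let ?c = "(k - 1) * ((n - 2 * k) choose (k - 2))"
  show "card large \<le> card missing"
  proof (rule double_counting_card_le[where R = "\<lambda>D B. card (B \<inter> D) = 1"])
    show "finite large" "finite missing" by (rule finite_large finite_missing)+
    show "?c \<le> card {B \<in> missing. card (B \<inter> D) = 1}" if D: "D \<in> large" for D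
    proof -
      let ?C = "{C. C \<subseteq> verts G - D \<and> card C = k - 2}"
      \<comment> \<open>The set \<open>D\<close> cuts \<open>x\<close> out of
        \<open>insert x C\<close>, so the pair can be recovered and pairs may be counted in place of
        missing sets.\<close>
      let ?S = "SIGMA C:?C. {x \<in> D. insert x C \<notin> edges G}"
      have finC: "finite ?C" using G_simps(1) by (auto intro: finite_subset[of _ "Pow (verts G)"])
      have finC': "finite C" if "C \<in> ?C" for C using that G_simps(1) finite_subset by blast
      have each: "k - 1 \<le> card {x \<in> D. insert x C \<notin> edges G}" if C: "C \<in> ?C" for C
      proof -
        have "card {x \<in> D. insert x C \<in> edges G} \<le> 1"
        proof -
          have "x = y" if "x \<in> D" "insert x C \<in> edges G" "y \<in> D" "insert y C \<in> edges G" for x y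
            using no_copy_large[OF D that(1,3) _ _ _ that(2,4)] C by blast
          then show ?thesis
            using card_le_Suc0_iff_eq[of "{x \<in> D. insert x C \<in> edges G}"] largeD(4)[OF D] by auto
        qed
        moreover have "D - {x \<in> D. insert x C \<in> edges G} = {x \<in> D. insert x C \<notin> edges G}" by blast
        then have "card {x \<in> D. insert x C \<notin> edges G} = card D - card {x \<in> D. insert x C \<in> edges G}"
          using card_Diff_subset[of "{x \<in> D. insert x C \<in> edges G}" D] largeD(4)[OF D] by auto
        ultimately show ?thesis using largeD(2)[OF D] by linarith
      qed
      have "card ?C = (n - card D) choose (k - 2)"
        using G_simps(1) n largeD(3,4)[OF D] by (simp add: n_subsets card_Diff_subset)
      moreover have "(n - 2 * k) choose (k - 2) \<le> (n - card D) choose (k - 2)"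
        using card_large_less[OF D] by (intro binomial_right_mono) simp
      ultimately have "?c \<le> (k - 1) * card ?C" by simp
      also have "\<dots> \<le> (\<Sum>C\<in>?C. card {x \<in> D. insert x C \<notin> edges G})"
        using sum_bounded_below[of ?C "k - 1" "\<lambda>C. card {x \<in> D. insert x C \<notin> edges G}"] each by (simp add: mult.commute)
      also have "\<dots> = card ?S"
        using finC largeD(4)[OF D] by (intro card_SigmaI[symmetric]) auto
      also have "\<dots> \<le> card {B \<in> missing. card (B \<inter> D) = 1}"
      proof (rule card_inj_on_le[where f = "\<lambda>(C, x). insert x C"])
        show "inj_on (\<lambda>(C, x). insert x C) ?S"
        proof (rule inj_onI)
          fix p q assume p: "p \<in> ?S" and q: "q \<in> ?S"
            and eq: "(\<lambda>(C, x). insert x C) p = (\<lambda>(C, x). insert x C) q"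
          obtain C x C' x' where pq: "p = (C, x)" "q = (C', x')" by (metis surj_pair)
          have "C = insert x C - D" "{x} = insert x C \<inter> D" using p pq(1) by auto
          moreover have "C' = insert x' C' - D" "{x'} = insert x' C' \<inter> D" using q pq(2) by auto
          moreover have "insert x C = insert x' C'" using eq pq by simp
          ultimately have "C = C'" "{x} = {x'}" by metis+
          then show "p = q" using pq by simp
        qed
        show "(\<lambda>(C, x). insert x C) ` ?S \<subseteq> {B \<in> missing. card (B \<inter> D) = 1}"
        proof
          fix B assume "B \<in> (\<lambda>(C, x). insert x C) ` ?S"
          then obtain C x where Cx: "C \<in> ?C" "x \<in> D" "insert x C \<notin> edges G" "B = insert x C" by auto
          have "x \<notin> C" using Cx by blast
          then have "card B = k - 1" using Cx finC'[OF Cx(1)] k by simp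
          moreover have "B \<inter> D = {x}" using Cx by blast
          moreover have "B \<subseteq> verts G" using Cx largeD(3)[OF D] by blast
          ultimately show "B \<in> {B \<in> missing. card (B \<inter> D) = 1}"
            using Cx(3,4) by (simp add: missing_def)
        qed
      qed (use finite_missing in simp)
      finally show ?thesis .
    qed
    show "card {D \<in> large. card (B \<inter> D) = 1} \<le> ?c" if B: "B \<in> missing" for B
    proof -
      have finB: "finite B" "card B = k - 1"
        using B k3 unfolding missing_def by (auto intro: card_ge_0_finite)
      have "{D \<in> large. card (B \<inter> D) = 1} \<subseteq> (\<Union>x\<in>B. {D \<in> large. x \<in> D})"
        by (auto simp: card_1_singleton_iff)
      then have "card {D \<in> large. card (B \<inter> D) = 1} \<le> card (\<Union>x\<in>B. {D \<in> large. x \<in> D})"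
        using finB finite_large by (intro card_mono) auto
      also have "\<dots> \<le> (\<Sum>x\<in>B. card {D \<in> large. x \<in> D})" using finB by (intro card_UN_le)
      also have "\<dots> \<le> ?c"
        using sum_bounded_above[of B "\<lambda>x. card {D \<in> large. x \<in> D}"] card_vertex_degree[OF ev] finB by simp
      finally show ?thesis .
    qed
    \<comment> \<open>From \<open>n \<ge> 3 * k\<close> one has
      \<open>n - 2 * k \<ge> k - 2\<close>, so the binomial coefficient does not vanish.\<close>
    show "0 < ?c" using n3 k by (simp add: zero_less_binomial_iff)
  qed simp
qed

end

lemma trivial_if_config_iv:
  fixes F :: "'a hypergraph"
  assumes F: "simplicial_complex F" "complex_dim F = int k - 1" and k3: "k \<ge> 3"
    and iso: "isomorphic (config_iv k) (Hypergraph (verts F) (maximal_edges F))"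
  shows "trivial_complex k F"
proof -
  have k: "k \<ge> 2" using k3 by simp
  obtain h where h: "inj_on h {1..2*k-2}"
    "maximal_edges F = (\<lambda>e. h ` e) ` {{1..k}, insert 1 {k+1..2*k-2}, insert 2 {k+1..2*k-2}}"
    using iso unfolding isomorphic_def config_iv_def bij_betw_def by auto
  let ?A = "h ` {1..k}" and ?C = "h ` {k+1..2*k-2}"
  have inj: "inj_on h {1..k}" "inj_on h {k+1..2*k-2}"
    by (rule inj_on_subset[OF h(1)], use k3 in auto)+
  have props: "maximal_edges F = {?A, insert (h 1) ?C, insert (h 2) ?C}"
    "card ?A = k" "card ?C = k - 2" "h 1 \<in> ?A" "h 2 \<in> ?A" "h 1 \<noteq> h 2" "?A \<inter> ?C = {}"
  proof -
    show "maximal_edges F = {?A, insert (h 1) ?C, insert (h 2) ?C}" unfolding h(2) by simp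
    show "card ?A = k" "card ?C = k - 2" using card_image[OF inj(1)] card_image[OF inj(2)] by auto
    show "h 1 \<in> ?A" "h 2 \<in> ?A" using k3 by auto
    have m: "(1::nat) \<in> {1..2*k-2}" "2 \<in> {1..2*k-2}" using k3 by auto
    show "h 1 \<noteq> h 2" using inj_on_eq_iff[OF h(1) m] by simp
    have "{1..k} \<inter> {k+1..2*k-2} = {}" by auto
    moreover have "{1..k} \<subseteq> {1..2*k-2}" "{k+1..2*k-2} \<subseteq> {1..2*k-2}" using k3 by auto
    ultimately show "?A \<inter> ?C = {}"
      using inj_on_image_Int[OF h(1), of "{1..k}" "{k+1..2*k-2}"] by simp
  qed
  show ?thesis
  proof (rule trivial_complexI[OF k F],
      rule eventually_mono[OF eventually_conj[OF eventually_pair_degree_bound[of "k - 3" "2 ^ (2 * k + k * k)" "2 * k"]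
        eventually_ge_at_top[of "3 * k"]]], intro allI impI)
    fix n and G :: "nat hypergraph"
    assume ev: "n * ((n choose (k - 3)) + 2 ^ (2 * k + k * k) * binom_sum n (k - 3))
      \<le> (k - 3 + 2) * ((n - 2 * k) choose Suc (k - 3)) \<and> 3 * k \<le> n"
      and G: "simplicial_complex G" "card (verts G) = n" "\<not> embeds F G"
    interpret three_maximal_edges F k G n ?A ?C "h 1" "h 2"
      by unfold_locales (fact k F G k3 props)+
    show "card (edges G) \<le> binom_sum n k" by (rule bound) (use ev in auto)
  qed
qed

subsection \<open>The exact value for disjoint maximal edges\<close>

lemma card_subsets_Int_Diff:
  assumes "finite V" "S \<subseteq> V"
  shows "card {T. T \<subseteq> V \<and> card (T \<inter> S) = r \<and> card (T - S) = j}
    = (card S choose r) * ((card V - card S) choose j)"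
proof -
  let ?A = "{X. X \<subseteq> S \<and> card X = r} \<times> {Y. Y \<subseteq> V - S \<and> card Y = j}"
  have finS: "finite S" using assms finite_subset by blast
  have "bij_betw (\<lambda>T. (T \<inter> S, T - S)) {T. T \<subseteq> V \<and> card (T \<inter> S) = r \<and> card (T - S) = j} ?A"
  proof (rule bij_betw_byWitness[where f' = "\<lambda>(X, Y). X \<union> Y"])
    show "(\<lambda>(X, Y). X \<union> Y) ` ?A \<subseteq> {T. T \<subseteq> V \<and> card (T \<inter> S) = r \<and> card (T - S) = j}"
    proof
      fix T assume "T \<in> (\<lambda>(X, Y). X \<union> Y) ` ?A"
      then obtain X Y where XY: "X \<subseteq> S" "card X = r" "Y \<subseteq> V - S" "card Y = j" "T = X \<union> Y" by auto
      then have "T \<inter> S = X" "T - S = Y" "T \<subseteq> V" using assms(2) by blast+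
      then show "T \<in> {T. T \<subseteq> V \<and> card (T \<inter> S) = r \<and> card (T - S) = j}" using XY by simp
    qed
  qed auto
  then have "card {T. T \<subseteq> V \<and> card (T \<inter> S) = r \<and> card (T - S) = j} = card ?A"
    by (rule bij_betw_same_card)
  then show ?thesis
    using assms finS by (simp add: card_cartesian_product n_subsets card_Diff_subset)
qed

text \<open>For \<open>r\<close> vertices in \<open>S\<close> and \<open>k - i\<close> off it, the
  two size conditions say \<open>i \<le> r\<close> and \<open>1 \<le> i\<close>. The guard
  \<open>i \<le> k\<close> expresses that a binomial coefficient with negative lower entry is 0; the
  truncated \<open>k - i\<close> would give the factor 1 instead.\<close>

lemma card_large_sets_near:
  assumes V: "finite V" "S \<subseteq> V"
  shows "card {T. T \<subseteq> V \<and> k \<le> card T \<and> card (T - S) < k}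
    = (\<Sum>r=1..card S. \<Sum>i=1..r.
        (if i \<le> k then (card S choose r) * ((card V - card S) choose (k - i)) else 0))"
proof -
  let ?I = "\<lambda>r. {i \<in> {1..r}. i \<le> k}"
  let ?P = "SIGMA r:{1..card S}. ?I r"
  let ?X = "\<lambda>(r, i). {T. T \<subseteq> V \<and> card (T \<inter> S) = r \<and> card (T - S) = k - i}"
  have finS: "finite S" using V finite_subset by blast
  have union: "{T. T \<subseteq> V \<and> k \<le> card T \<and> card (T - S) < k} = (\<Union>p\<in>?P. ?X p)"
  proof (intro equalityI subsetI)
    fix T assume "T \<in> {T. T \<subseteq> V \<and> k \<le> card T \<and> card (T - S) < k}"
    then have T: "T \<subseteq> V" "k \<le> card T" "card (T - S) < k" by auto
    have "card T = card (T \<inter> S) + card (T - S)"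
      using T(1) V(1) finite_subset by (metis card_Int_Diff)
    moreover have "card (T \<inter> S) \<le> card S" using finS by (intro card_mono) auto
    ultimately have "(card (T \<inter> S), k - card (T - S)) \<in> ?P" "T \<in> ?X (card (T \<inter> S), k - card (T - S))"
      using T by auto
    then show "T \<in> (\<Union>p\<in>?P. ?X p)" by blast
  next
    fix T assume "T \<in> (\<Union>p\<in>?P. ?X p)"
    then obtain r i where T: "1 \<le> i" "i \<le> r" "i \<le> k" "T \<subseteq> V" "card (T \<inter> S) = r" "card (T - S) = k - i"
      by auto
    have "card T = card (T \<inter> S) + card (T - S)"
      using T(4) V(1) finite_subset by (metis card_Int_Diff)
    then show "T \<in> {T. T \<subseteq> V \<and> k \<le> card T \<and> card (T - S) < k}" using T by auto
  qed
  have "card {T. T \<subseteq> V \<and> k \<le> card T \<and> card (T - S) < k} = (\<Sum>p\<in>?P. card (?X p))"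
    unfolding union
  proof (rule card_UN_disjoint)
    show "\<forall>p\<in>?P. finite (?X p)" using V by (auto intro: finite_subset[of _ "Pow V"])
    show "\<forall>p\<in>?P. \<forall>q\<in>?P. p \<noteq> q \<longrightarrow> ?X p \<inter> ?X q = {}"
    proof (intro ballI impI)
      fix p q assume pq: "p \<in> ?P" "q \<in> ?P" "p \<noteq> q"
      obtain r i r' i' where e: "p = (r, i)" "q = (r', i')" by (metis surj_pair)
      have False if "T \<in> ?X p" "T \<in> ?X q" for T
      proof -
        have "r = r'" "k - i = k - i'" using that e by auto
        moreover have "i \<le> k" "i' \<le> k" using pq e by auto
        ultimately show False using pq(3) e by auto
      qed
      then show "?X p \<inter> ?X q = {}" by blast
    qed
  qed auto
  also have "\<dots> = (\<Sum>(r, i)\<in>?P. (card S choose r) * ((card V - card S) choose (k - i)))"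
    by (intro sum.cong refl) (simp only: split_def card_subsets_Int_Diff[OF V])
  also have "\<dots> = (\<Sum>r=1..card S. \<Sum>i\<in>?I r. (card S choose r) * ((card V - card S) choose (k - i)))"
    by (rule sum.Sigma[symmetric]) auto
  also have "\<dots> = (\<Sum>r=1..card S. \<Sum>i=1..r.
        (if i \<le> k then (card S choose r) * ((card V - card S) choose (k - i)) else 0))"
    by (intro sum.cong sum.inter_filter) auto
  finally show ?thesis .
qed

text \<open>The gain consists of the \<open>k\<close>-sets made of \<open>x\<close> and
  \<open>k - 1\<close> vertices off \<open>S\<close>. Being of order n^(k-1), it absorbs the
  exceptional edges when there are fewer than \<open>t - 1\<close> rich vertices.\<close>

lemma card_large_sets_near_extend:
  assumes V: "finite V" and S: "S0 \<subseteq> S" "S \<subseteq> V" "x \<in> S - S0" and k: "k \<ge> 1"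
  shows "card {T. T \<subseteq> V \<and> k \<le> card T \<and> card (T - S0) < k} + ((card V - card S) choose (k - 1))
    \<le> card {T. T \<subseteq> V \<and> k \<le> card T \<and> card (T - S) < k}"
proof -
  let ?f = "\<lambda>S. {T. T \<subseteq> V \<and> k \<le> card T \<and> card (T - S) < k}"
  let ?R = "{R. R \<subseteq> V - S \<and> card R = k - 1}"
  have finV: "finite T" if "T \<subseteq> V" for T using that V finite_subset by blast
  have fins: "finite {T. T \<subseteq> V \<and> P T}" for P using V by (auto intro: finite_subset[of _ "Pow V"])
  have finR: "finite ?R" using V by (auto intro: finite_subset[of _ "Pow V"])
  have R: "insert x R \<in> ?f S" "insert x R \<notin> ?f S0" if "R \<in> ?R" for R
  proof -
    have "finite R" "x \<notin> R" "x \<in> V" using that S finV by auto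
    then have c: "card (insert x R) = k" using that k by simp
    have "insert x R - S = R" "insert x R - S0 = insert x R" using that S by blast+
    then show "insert x R \<in> ?f S" "insert x R \<notin> ?f S0" using c that k \<open>x \<in> V\<close> by auto
  qed
  have "inj_on (insert x) ?R"
  proof (rule inj_onI)
    fix R R' assume RR: "R \<in> ?R" "R' \<in> ?R" "insert x R = insert x R'"
    then have "x \<notin> R" "x \<notin> R'" using S(3) by auto
    then show "R = R'" using RR(3) insert_ident by metis
  qed
  then have "card (insert x ` ?R) = (card V - card S) choose (k - 1)"
    using V S finV[OF S(2)] by (simp add: card_image n_subsets card_Diff_subset)
  moreover have "card (?f S0) + card (insert x ` ?R) = card (?f S0 \<union> insert x ` ?R)"
    using fins finR R by (intro card_Un_disjoint[symmetric]) auto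
  moreover have "\<dots> \<le> card (?f S)"
  proof (rule card_mono[OF fins])
    have "?f S0 \<subseteq> ?f S"
    proof
      fix T assume T: "T \<in> ?f S0"
      then have "card (T - S) \<le> card (T - S0)" using S(1) finV[of "T - S0"] by (intro card_mono) auto
      then show "T \<in> ?f S" using T by auto
    qed
    then show "?f S0 \<union> insert x ` ?R \<subseteq> ?f S" using R by blast
  qed
  ultimately show ?thesis by linarith
qed

section \<open>Matchings and rich vertices\<close>

definition matching :: "nat \<Rightarrow> 'a hypergraph \<Rightarrow> 'a set set \<Rightarrow> bool" where
  "matching k G M \<longleftrightarrow> M \<subseteq> edges G \<and> pairwise disjnt M \<and> (\<forall>e\<in>M. card e = k)"

text \<open>Rich vertices can be added to a matching greedily.\<close>
definition rich :: "nat \<Rightarrow> 'a hypergraph \<Rightarrow> nat \<Rightarrow> 'a \<Rightarrow> bool" where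
  "rich k G b v \<longleftrightarrow> (\<forall>W. finite W \<longrightarrow> card W \<le> b \<longrightarrow> v \<notin> W \<longrightarrow>
     (\<exists>e\<in>edges G. card e = k \<and> v \<in> e \<and> e \<inter> W = {}))"

lemma matching_extend_rich:
  assumes G: "simplicial_complex G" and k: "k \<ge> 1"
    and "finite S" and "\<And>v. v \<in> S \<Longrightarrow> rich k G (t * k) v"
    and "matching k G M" "\<Union> M \<inter> S = {}" "card M + card S \<le> t"
  shows "\<exists>M'. matching k G M' \<and> card M' = card M + card S"
  using assms(3-)
proof (induction S arbitrary: M rule: finite_induct)
  case empty
  then show ?case by auto
next
  case (insert v S)
  have finM: "finite M"
    using insert.prems(2) simplicial_complexD(2)[OF G] finite_subset unfolding matching_def by blast
  \<comment> \<open>The new edge must also avoid the remaining vertices of \<open>S\<close>, so that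
    they stay off the matching and can be used later.\<close>
  let ?W = "\<Union> M \<union> S"
  have "\<Union> M \<subseteq> verts G" using insert.prems(2) simplicial_complexD(5)[OF G] unfolding matching_def by blast
  then have finW: "finite ?W" using insert.hyps(1) simplicial_complexD(1)[OF G] finite_subset by blast
  have "card ?W \<le> card M * k + card S"
    using card_Un_le[of "\<Union> M" S] card_Union_uniform_le[of M k] insert.prems(2)
    unfolding matching_def by fastforce
  also have "\<dots> \<le> (card M + card S) * k" using k by (simp add: add_mult_distrib)
  also have "\<dots> \<le> t * k" using insert.prems(4) insert.hyps by (intro mult_le_mono1) auto
  finally have "card ?W \<le> t * k" .
  moreover have "v \<notin> ?W" using insert.hyps(2) insert.prems(3) by blast
  ultimately obtain e where e: "e \<in> edges G" "card e = k" "v \<in> e" "e \<inter> ?W = {}"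
    using insert.prems(1)[of v] finW unfolding rich_def by blast
  have "e \<notin> M" using e(3) insert.prems(3) by blast
  then have c: "card (insert e M) = Suc (card M)" using finM by simp
  have "matching k G (insert e M)"
    using insert.prems(2) e unfolding matching_def pairwise_insert disjnt_def by blast
  moreover have "\<Union> (insert e M) \<inter> S = {}" using e(4) insert.prems(3) by blast
  moreover have "card (insert e M) + card S \<le> t" using insert.prems(4) insert.hyps c by simp
  ultimately obtain M' where "matching k G M'" "card M' = card (insert e M) + card S"
    using insert.IH[of "insert e M"] insert.prems(1) by blast
  then show ?case using c insert.hyps by auto
qed

lemma matching_subset: "matching k G M \<Longrightarrow> M' \<subseteq> M \<Longrightarrow> matching k G M'"
  unfolding matching_def by (auto intro: pairwise_subset)

text \<open>If there are \<open>t - 1\<close> rich vertices, a \<open>k\<close>-edge avoiding them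
  would lead to a matching of size \<open>t\<close>. If there are fewer, the edges with
  \<open>k\<close> vertices off them cluster around a bounded set \<open>W\<close>, and enlarging
  the rich set to \<open>S\<close> compensates for all of these.\<close>

lemma card_large_edges_no_matching:
  assumes G: "simplicial_complex G" and k: "k \<ge> 2" and t: "t \<ge> 1" and n: "card (verts G) = n" "n \<ge> t"
    and no: "\<And>M. matching k G M \<Longrightarrow> card M \<noteq> t"
    and ev: "2 ^ (t + t * k + t * k * (t * k)) * binom_sum n (k - 1) \<le> (n - t) choose (k - 1)"
  obtains S where "S \<subseteq> verts G" "card S = t - 1"
    "card {T \<in> edges G. k \<le> card T} \<le> card {T. T \<subseteq> verts G \<and> k \<le> card T \<and> card (T - S) < k}"
proof -
  note Gs = simplicial_complexD[OF G]
  let ?f = "\<lambda>S. {T. T \<subseteq> verts G \<and> k \<le> card T \<and> card (T - S) < k}"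
  have fins: "finite {T. T \<subseteq> verts G \<and> P T}" for P
    using Gs(1) by (auto intro: finite_subset[of _ "Pow (verts G)"])
  define S0 where "S0 = {v \<in> verts G. rich k G (t * k) v}"
  have S0: "finite S0" "S0 \<subseteq> verts G" using Gs(1) by (auto simp: S0_def)
  have small: "card M < t" if "matching k G M" for M
  proof (rule ccontr)
    assume "\<not> card M < t"
    then obtain M' where "M' \<subseteq> M" "card M' = t" by (metis not_less obtain_subset_with_card_n)
    then show False using no matching_subset[OF that] by blast
  qed
  have sum: "card M + card S0 < t" if M: "matching k G M" "\<Union> M \<inter> S0 = {}" for M
  proof (rule ccontr)
    assume "\<not> card M + card S0 < t"
    then have "t - card M \<le> card S0" by simp
    then obtain S' where S': "S' \<subseteq> S0" "card S' = t - card M" "finite S'"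
      by (metis obtain_subset_with_card_n)
    have "\<exists>M'. matching k G M' \<and> card M' = card M + card S'"
    proof (rule matching_extend_rich[where t = t])
      show "\<Union> M \<inter> S' = {}" using M(2) S'(1) by blast
      show "rich k G (t * k) v" if "v \<in> S'" for v using that S'(1) by (auto simp: S0_def)
    qed (use G k S' M small[OF M(1)] in auto)
    then show False using no small[OF M(1)] S'(2) by auto
  qed
  have "matching k G {}" by (simp add: matching_def)
  then have cS0: "card S0 < t" using sum[of "{}"] by simp
  show ?thesis
  proof (cases "card S0 = t - 1")
    case True
    have "{T \<in> edges G. k \<le> card T} \<subseteq> ?f S0"
    proof
      fix T assume T: "T \<in> {T \<in> edges G. k \<le> card T}"
      have "card (T - S0) < k"
      proof (rule ccontr)
        assume "\<not> card (T - S0) < k"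
        then obtain e where e: "e \<subseteq> T - S0" "card e = k" by (metis not_less obtain_subset_with_card_n)
        then have "matching k G {e}" using T Gs(7)[of T e] by (auto simp: matching_def)
        then show False using sum[of "{e}"] e(1) True t by auto
      qed
      then show "T \<in> ?f S0" using T Gs(5) by auto
    qed
    from that[OF S0(2) True card_mono[OF fins this]] show ?thesis .
  next
    case False
    define E where "E = {e \<in> edges G. card e = k \<and> e \<inter> S0 = {}}"
    have finE: "finite E" using Gs(2) by (simp add: E_def)
    obtain N where N: "N \<subseteq> E" "pairwise disjnt N" "\<And>e. e \<in> E \<Longrightarrow> e \<noteq> {} \<Longrightarrow> e \<inter> \<Union> N \<noteq> {}"
      using maximal_disjoint_subfamily[OF finE] by metis
    have mN: "matching k G N" using N(1,2) unfolding matching_def E_def by blast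
    let ?Q = "\<Union> N"
    have QV: "?Q \<subseteq> verts G" using N(1) Gs(5) unfolding E_def by blast
    then have finQ: "finite ?Q" using Gs(1) finite_subset by blast
    have "card ?Q \<le> card N * k" using mN by (intro card_Union_uniform_le) (simp add: matching_def)
    also have "\<dots> \<le> t * k" using small[OF mN] by simp
    finally have cQ: "card ?Q \<le> t * k" .
    \<comment> \<open>A vertex that is not rich comes with a bounded set hitting every
      \<open>k\<close>-edge through it.\<close>
    have "\<exists>W. finite W \<and> card W \<le> t * k \<and> q \<notin> W \<and> (\<forall>e\<in>edges G. card e = k \<longrightarrow> q \<in> e \<longrightarrow> e \<inter> W \<noteq> {})"
      if "q \<in> ?Q" for q
    proof -
      have "q \<notin> S0" using that N(1) unfolding E_def by blast
      then have "\<not> rich k G (t * k) q" using that QV unfolding S0_def by blast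
      then show ?thesis unfolding rich_def by blast
    qed
    then obtain w where w: "\<And>q. q \<in> ?Q \<Longrightarrow> finite (w q)" "\<And>q. q \<in> ?Q \<Longrightarrow> card (w q) \<le> t * k"
      "\<And>q. q \<in> ?Q \<Longrightarrow> q \<notin> w q"
      "\<And>q e. q \<in> ?Q \<Longrightarrow> e \<in> edges G \<Longrightarrow> card e = k \<Longrightarrow> q \<in> e \<Longrightarrow> e \<inter> w q \<noteq> {}"
      by metis
    \<comment> \<open>The exponent in \<open>ev\<close> is the sum of the bounds for these three
      pieces.\<close>
    define W where "W = S0 \<union> ?Q \<union> (\<Union>q\<in>?Q. w q)"
    have finW: "finite W" unfolding W_def using S0 finQ w(1) by blast
    have "card (\<Union>q\<in>?Q. w q) \<le> (\<Sum>q\<in>?Q. card (w q))" using finQ by (rule card_UN_le)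
    also have "\<dots> \<le> card ?Q * (t * k)" using sum_bounded_above[of ?Q "\<lambda>q. card (w q)" "t * k"] w(2) by simp
    also have "\<dots> \<le> t * k * (t * k)" using cQ by (rule mult_le_mono1)
    finally have cw: "card (\<Union>q\<in>?Q. w q) \<le> t * k * (t * k)" .
    have "card W \<le> card S0 + card ?Q + card (\<Union>q\<in>?Q. w q)"
      unfolding W_def using card_Un_le[of S0 ?Q] card_Un_le[of "S0 \<union> ?Q" "\<Union>q\<in>?Q. w q"] by linarith
    then have cW: "card W \<le> t + t * k + t * k * (t * k)" using cS0 cQ cw by linarith
    have near: "card (T - W) < k - 1" if T: "T \<in> edges G" "k \<le> card (T - S0)" for T
    proof (rule ccontr)
      assume "\<not> card (T - W) < k - 1"
      then obtain R where R: "R \<subseteq> T - W" "card R = k - 1" by (metis not_less obtain_subset_with_card_n)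
      \<comment> \<open>\<open>T\<close> contains a \<open>k\<close>-edge off \<open>S0\<close> and
        hence a vertex \<open>q\<close> of \<open>\<Union> N\<close>; together with
        \<open>k - 1\<close> vertices off \<open>W\<close> this \<open>q\<close> forms a
        \<open>k\<close>-edge that misses \<open>w q\<close>.\<close>
      obtain e where e: "e \<subseteq> T - S0" "card e = k" using T(2) by (metis obtain_subset_with_card_n)
      have "e \<in> E" using e Gs(7)[OF T(1), of e] unfolding E_def by blast
      moreover have "e \<noteq> {}" using e(2) k by auto
      ultimately obtain q where q: "q \<in> e" "q \<in> ?Q" using N(3) by blast
      have "q \<notin> R" using q(2) R(1) unfolding W_def by blast
      moreover have "finite R" using R(1) Gs(6)[OF T(1)] by (auto intro: finite_subset)
      ultimately have "card (insert q R) = k" using R(2) k by simp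
      moreover have "insert q R \<subseteq> T" using R(1) q(1) e(1) by blast
      then have "insert q R \<in> edges G" by (rule Gs(7)[OF T(1)])
      ultimately have "insert q R \<inter> w q \<noteq> {}" using w(4)[OF q(2)] by blast
      then have "R \<inter> w q \<noteq> {}" using w(3)[OF q(2)] by blast
      then show False using R(1) q(2) unfolding W_def by blast
    qed
    have "{T \<in> edges G. k \<le> card T} \<subseteq> ?f S0 \<union> {T. T \<subseteq> verts G \<and> card (T - W) < k - 1}"
    proof
      fix T assume "T \<in> {T \<in> edges G. k \<le> card T}"
      then show "T \<in> ?f S0 \<union> {T. T \<subseteq> verts G \<and> card (T - W) < k - 1}"
        using near[of T] Gs(5)[of T] by (cases "card (T - S0) < k") auto
    qed
    then have "card {T \<in> edges G. k \<le> card T}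
        \<le> card (?f S0 \<union> {T. T \<subseteq> verts G \<and> card (T - W) < k - 1})"
      using fins by (intro card_mono finite_UnI) auto
    also have "\<dots> \<le> card (?f S0) + card {T. T \<subseteq> verts G \<and> card (T - W) < k - 1}" by (rule card_Un_le)
    also have "card {T. T \<subseteq> verts G \<and> card (T - W) < k - 1} \<le> 2 ^ card W * binom_sum n (k - 1)"
      using card_near_subsets_le[OF Gs(1) finW] n by simp
    also have "\<dots> \<le> 2 ^ (t + t * k + t * k * (t * k)) * binom_sum n (k - 1)" using cW by simp
    also have "\<dots> \<le> (n - t) choose (k - 1)" by (rule ev)
    finally have 1: "card {T \<in> edges G. k \<le> card T} \<le> card (?f S0) + ((n - t) choose (k - 1))" by simp
    have "card S0 \<le> t - 1" "t - 1 \<le> card (verts G)" using cS0 n by auto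
    then obtain S where S: "S0 \<subseteq> S" "S \<subseteq> verts G" "card S = t - 1"
      using obtain_subset_between[OF S0(2) Gs(1)] by metis
    have "S0 \<noteq> S" using S(3) False by blast
    then obtain x where x: "x \<in> S - S0" using S(1) by blast
    have "(n - t) choose (k - 1) \<le> (card (verts G) - card S) choose (k - 1)"
      using S(3) n by (intro binomial_right_mono) simp
    then have "card {T \<in> edges G. k \<le> card T} \<le> card (?f S)"
      using card_large_sets_near_extend[OF Gs(1) S(1,2) x, of k] 1 k by linarith
    from that[OF S(2,3) this] show ?thesis .
  qed
qed

lemma card_disjoint_family_le_transversal:
  assumes "pairwise disjnt M" "finite S" "\<And>e. e \<in> M \<Longrightarrow> e \<inter> S \<noteq> {}"
  shows "card M \<le> card S"
proof -
  define f where "f e = (SOME x. x \<in> e \<inter> S)" for e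
  have f: "f e \<in> e \<inter> S" if "e \<in> M" for e
    unfolding f_def using assms(3)[OF that] by (metis ex_in_conv someI_ex)
  have "inj_on f M"
  proof (rule inj_onI)
    fix e e' assume "e \<in> M" "e' \<in> M" "f e = f e'"
    then have "\<not> disjnt e e'" using f[of e] f[of e'] unfolding disjnt_def by auto
    then show "e = e'" using assms(1) \<open>e \<in> M\<close> \<open>e' \<in> M\<close> unfolding pairwise_def by blast
  qed
  moreover have "f ` M \<subseteq> S" using f by blast
  ultimately show ?thesis using assms(2) by (rule card_inj_on_le)
qed

text \<open>An \<open>F\<close>-free host with a matching of \<open>t\<close> edges falls under the
  earlier bound. The extremal complex consists of all sets with fewer than \<open>k\<close> vertices
  off a fixed \<open>(t-1)\<close>-set: each of its \<open>k\<close>-edges meets that set, so no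
  \<open>t\<close> of them are disjoint.\<close>

lemma ex_complex_disjoint_maximal_edges:
  fixes F :: "'a hypergraph"
  assumes k: "k \<ge> 2" and F: "simplicial_complex F" "complex_dim F = int k - 1"
    and disj: "pairwise disjnt (maximal_edges F)"
  defines "t \<equiv> card (edges (uniform_part F k))"
  shows "\<forall>\<^sub>F n in sequentially. ex_complex n F =
      (\<Sum>r=1..t-1. \<Sum>i=1..r. (if i \<le> k then ((t - 1) choose r) * ((n - t + 1) choose (k - i)) else 0))
      + (\<Sum>r=0..k-1. n choose r)"
proof -
  let ?M0 = "edges (uniform_part F k)"
  have M0: "?M0 \<subseteq> maximal_edges F" by (rule uniform_part_subset_maximal[OF F])
  have disj0: "pairwise disjnt ?M0" using disj M0 by (rule pairwise_subset)
  have sub0: "e \<subseteq> verts F" if "e \<in> ?M0" for e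
    using that simplicial_complexD(5)[OF F(1)] by (auto simp: uniform_part_def)
  have "finite ?M0" using simplicial_complexD(2)[OF F(1)] by (simp add: uniform_part_def)
  moreover have "?M0 \<noteq> {}" using exists_edge_card_dim[OF F] by (auto simp: uniform_part_def)
  ultimately have t: "t \<ge> 1" unfolding t_def by (simp add: Suc_le_eq card_gt_0_iff)
  show ?thesis
    using disjoint_maximal_edges_bound[OF k F disj] eventually_ge_at_top[of t]
      eventually_binom_sum_le_binomial[of "2 ^ (t + t * k + t * k * (t * k))" "k - 1" t]
  proof eventually_elim
    case (elim n)
    note bound = elim(1)[folded t_def] and nt = elim(2)
    let ?f = "\<Sum>r=1..t-1. \<Sum>i=1..r. (if i \<le> k then ((t - 1) choose r) * ((n - t + 1) choose (k - i)) else 0)"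
    \<comment> \<open>Both subtractions are truncated; they agree since
      \<open>1 \<le> t \<le> n\<close>.\<close>
    have nt': "n - t + 1 = n - (t - 1)" using nt t by simp
    have bs: "(\<Sum>r=0..k-1. n choose r) = binom_sum n k"
      unfolding binom_sum_def using k by (intro sum.cong) auto
    have count: "card {T. T \<subseteq> V \<and> k \<le> card T \<and> card (T - S) < k} = ?f"
      if "finite V" "card V = n" "S \<subseteq> V" "card S = t - 1" for V S :: "nat set"
      unfolding card_large_sets_near[OF that(1,3)] that(2,4) nt' ..
    have "ex_complex n F \<le> ?f + binom_sum n k"
    proof -
      obtain G0 :: "nat hypergraph" where G0: "simplicial_complex G0" "card (verts G0) = n"
        "\<And>e. e \<in> edges G0 \<Longrightarrow> card e < k"
        using exists_complex_without_k_edge[OF k] by metis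
      have nG0: "\<not> embeds F G0" using not_embeds_if_no_k_edge[OF F] G0(3) by (metis nat_neq_iff)
      obtain G :: "nat hypergraph" where G: "simplicial_complex G" "card (verts G) = n" "\<not> embeds F G"
        "card (edges G) = ex_complex n F"
        by (rule ex_complex_attained[OF G0(1,2) nG0])
      show ?thesis
      proof (cases "\<exists>M. matching k G M \<and> card M = t")
        case True
        then have "card (edges G) \<le> binom_sum n k"
          using bound G unfolding matching_def by blast
        then show ?thesis using G(4) by linarith
      next
        case False
        then have no: "card M \<noteq> t" if "matching k G M" for M using that by blast
        show ?thesis
        proof (rule card_large_edges_no_matching[OF G(1) k t G(2) nt no elim(3)])
          fix S assume S: "S \<subseteq> verts G" "card S = t - 1"
            "card {T \<in> edges G. k \<le> card T} \<le> card {T. T \<subseteq> verts G \<and> k \<le> card T \<and> card (T - S) < k}"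
          then show ?thesis
            using count[OF simplicial_complexD(1)[OF G(1)] G(2) S(1,2)]
              card_edges_split[OF G(1), of k] card_small_edges_le[OF G(1), of k] unfolding G(2,4) by linarith
        qed
      qed
    qed
    moreover have "?f + binom_sum n k \<le> ex_complex n F"
    proof -
      define V where "V = {..<n}"
      define S where "S = {..<t - 1}"
      have VS: "finite V" "card V = n" "S \<subseteq> V" "card S = t - 1" "finite S"
        using nt by (auto simp: V_def S_def)
      define K where "K = Hypergraph V {T. T \<subseteq> V \<and> card (T - S) < k}"
      have finT: "finite T" if "T \<subseteq> V" for T using that VS(1) finite_subset by blast
      have K: "simplicial_complex K"
        unfolding K_def
      proof (rule simplicial_complex_Collect)
        fix e e' assume e: "e \<in> {T. T \<subseteq> V \<and> card (T - S) < k}" "e' \<subseteq> e"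
        then have "card (e' - S) \<le> card (e - S)" using finT[of "e - S"] by (intro card_mono) auto
        then show "e' \<in> {T. T \<subseteq> V \<and> card (T - S) < k}" using e by auto
      next
        fix v assume "v \<in> V"
        moreover have "card ({v} - S) \<le> card {v}" by (intro card_mono) auto
        ultimately show "{v} \<in> {T. T \<subseteq> V \<and> card (T - S) < k}" using k by auto
      qed (use VS k in auto)
      have "\<not> embeds F K"
      proof
        assume "embeds F K"
        then obtain \<phi> where \<phi>: "inj_on \<phi> (verts F)" "\<forall>e\<in>edges F. \<phi> ` e \<in> edges K"
          unfolding embeds_def by blast
        note im = image_disjoint_family[OF \<phi>(1) sub0 disj0]
        have "card ((`) \<phi> ` ?M0) \<le> card S"
        proof (rule card_disjoint_family_le_transversal[OF im(2) VS(5)])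
          fix X assume "X \<in> (`) \<phi> ` ?M0"
          then obtain e where e: "e \<in> ?M0" "X = \<phi> ` e" by blast
          have "card X = k" unfolding e(2)
            using inj_on_subset[OF \<phi>(1) sub0[OF e(1)]] e(1) by (simp add: card_image uniform_part_def)
          moreover have "card (X - S) < k" using \<phi>(2) e by (auto simp: K_def uniform_part_def)
          ultimately show "X \<inter> S \<noteq> {}" by (metis Diff_triv less_irrefl)
        qed
        then show False using im(1) VS(4) t unfolding t_def by simp
      qed
      then have "card (edges K) \<le> ex_complex n F"
        using K VS(2) by (intro ex_complex_ge) (simp_all add: K_def)
      moreover have "{T \<in> edges K. card T < k} = {T. T \<subseteq> V \<and> card T < k}"
      proof -
        have "card (T - S) < k" if "T \<subseteq> V" "card T < k" for T
          using card_mono[OF finT[OF that(1)], of "T - S"] that(2) by auto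
        then show ?thesis by (auto simp: K_def)
      qed
      moreover have "{T \<in> edges K. k \<le> card T} = {T. T \<subseteq> V \<and> k \<le> card T \<and> card (T - S) < k}"
        by (auto simp: K_def)
      ultimately show ?thesis
        using card_edges_split[OF K, of k] count[OF VS(1-4)] card_subsets_less[OF VS(1), of k] VS(2) by simp
    qed
    ultimately show ?case using bs by simp
  qed
qed

subsection \<open>Full families\<close>

text \<open>Equivalently, each \<open>A - {x}\<close> below a member has more than \<open>b\<close>
  completions to a member, a lower bound on the positive codegree. Speaking of avoided sets
  \<open>W\<close> is the form in which embeddings use it.\<close>

definition full_family :: "nat \<Rightarrow> 'a set set \<Rightarrow> bool" where
  "full_family b H \<longleftrightarrow> (\<forall>A\<in>H. \<forall>x\<in>A. \<forall>W. finite W \<longrightarrow> card W \<le> b \<longrightarrow>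
     (\<exists>z. z \<notin> W \<and> z \<notin> A - {x} \<and> insert z (A - {x}) \<in> H))"

definition clique_sets :: "nat \<Rightarrow> 'a set set \<Rightarrow> 'a set set" where
  "clique_sets k H = {T. finite T \<and> k \<le> card T \<and> (\<forall>A. A \<subseteq> T \<longrightarrow> card A = k \<longrightarrow> A \<in> H)}"

definition lower_shadow :: "nat \<Rightarrow> 'a set set \<Rightarrow> 'a set set" where
  "lower_shadow k H = {S. card S = k - 1 \<and> (\<exists>A\<in>H. S \<subseteq> A)}"

lemma clique_sets_subset_Pow:
  assumes "k \<ge> 1"
  shows "clique_sets k H \<subseteq> Pow (\<Union> H)"
proof
  fix T assume T: "T \<in> clique_sets k H"
  have "x \<in> \<Union> H" if "x \<in> T" for x
  proof -
    have "{x} \<subseteq> T" "finite T" "card {x} \<le> k" "k \<le> card T"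
      using T that assms by (auto simp: clique_sets_def)
    then obtain A where "{x} \<subseteq> A" "A \<subseteq> T" "card A = k" by (rule obtain_subset_between)
    then show ?thesis using T unfolding clique_sets_def by blast
  qed
  then show "T \<in> Pow (\<Union> H)" by blast
qed

text \<open>Delete repeatedly all members of \<open>H\<close> above a \<open>(k - 1)\<close>-set of degree at most \<open>b\<close>. A clique first
  destroyed when \<open>S\<close> is processed consists of \<open>S\<close> and some of the at most \<open>b\<close> vertices completing \<open>S\<close>.\<close>
lemma card_clique_sets_le:
  fixes H :: "'a set set"
  assumes k: "k \<ge> 1" and "finite H" and "\<And>A. A \<in> H \<Longrightarrow> finite A \<and> card A = k"
    and "\<And>H'. H' \<subseteq> H \<Longrightarrow> H' \<noteq> {} \<Longrightarrow> \<not> full_family b H'"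
  shows "card (clique_sets k H) \<le> 2 ^ b * card (lower_shadow k H)"
  using assms(2-)
proof (induction H rule: finite_psubset_induct)
  case (psubset H)
  show ?case
  proof (cases "H = {}")
    case True
    have "clique_sets k H = {}"
    proof (rule ccontr)
      assume "clique_sets k H \<noteq> {}"
      then obtain T where "finite T" "k \<le> card T" "\<forall>A. A \<subseteq> T \<longrightarrow> card A = k \<longrightarrow> A \<in> H"
        unfolding clique_sets_def by blast
      then show False using True by (metis empty_iff obtain_subset_with_card_n)
    qed
    then show ?thesis by simp
  next
    case False
    have finU: "finite (\<Union> H)" using psubset.hyps(1) psubset.prems(1) by blast
    have "\<not> full_family b H" using psubset.prems(2) False by blast
    then obtain A x W where A: "A \<in> H" "x \<in> A" and W: "finite W" "card W \<le> b"
      and link: "\<And>z. z \<notin> A - {x} \<Longrightarrow> insert z (A - {x}) \<in> H \<Longrightarrow> z \<in> W"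
      unfolding full_family_def by blast
    define S where "S = A - {x}"
    have finS: "finite S" and cS: "card S = k - 1"
      using psubset.prems(1)[OF A(1)] A(2) by (auto simp: S_def)
    \<comment> \<open>Deleting all members above \<open>S\<close> removes \<open>S\<close> from the
      shadow, and this loss pays for the at most \<open>2 ^ b\<close> cliques destroyed.\<close>
    define H' where "H' = {B \<in> H. \<not> S \<subseteq> B}"
    have "H' \<subset> H" using A(1) by (auto simp: H'_def S_def)
    then have IH: "card (clique_sets k H') \<le> 2 ^ b * card (lower_shadow k H')"
      using psubset.prems by (intro psubset.IH) auto
    have fin_sh: "finite (lower_shadow k H)"
      using finU by (auto simp: lower_shadow_def intro: finite_subset[of _ "Pow (\<Union> H)"])
    have S_sh: "S \<notin> lower_shadow k H'" by (auto simp: lower_shadow_def H'_def)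
    have "insert S (lower_shadow k H') \<subseteq> lower_shadow k H"
      using A cS by (auto simp: lower_shadow_def H'_def S_def)
    from card_mono[OF fin_sh this] have sh: "Suc (card (lower_shadow k H')) \<le> card (lower_shadow k H)"
      using S_sh finite_subset[OF _ fin_sh, of "lower_shadow k H'"] \<open>insert S _ \<subseteq> _\<close> by simp
    have sub: "clique_sets k H \<subseteq> clique_sets k H' \<union> (\<lambda>X. S \<union> X) ` Pow W"
    proof
      fix T assume T: "T \<in> clique_sets k H"
      show "T \<in> clique_sets k H' \<union> (\<lambda>X. S \<union> X) ` Pow W"
      proof (cases "T \<in> clique_sets k H'")
        case False
        then obtain B where B: "B \<subseteq> T" "card B = k" "B \<notin> H'" using T by (auto simp: clique_sets_def)
        then have "B \<in> H" using T by (auto simp: clique_sets_def)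
        then have ST: "S \<subseteq> T" using B by (auto simp: H'_def)
        have "z \<in> W" if z: "z \<in> T - S" for z
        proof -
          have "insert z S \<subseteq> T" "card (insert z S) = k" using z ST finS cS k by auto
          then have "insert z S \<in> H" using T by (auto simp: clique_sets_def)
          then show ?thesis using link z by (auto simp: S_def)
        qed
        then have "T = S \<union> (T - S)" "T - S \<in> Pow W" using ST by auto
        then show ?thesis by blast
      qed simp
    qed
    have fin_cl: "finite (clique_sets k H')"
      using clique_sets_subset_Pow[OF k, of H'] finU \<open>H' \<subset> H\<close>
      by (meson Union_mono finite_Pow_iff finite_subset psubset_imp_subset)
    have "card (clique_sets k H) \<le> card (clique_sets k H' \<union> (\<lambda>X. S \<union> X) ` Pow W)"
      using fin_cl W by (intro card_mono sub) auto
    also have "\<dots> \<le> card (clique_sets k H') + card ((\<lambda>X. S \<union> X) ` Pow W)" by (rule card_Un_le)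
    also have "card ((\<lambda>X. S \<union> X) ` Pow W) \<le> card (Pow W)" using W by (intro card_image_le) simp
    also have "card (Pow W) = 2 ^ card W" using W by (simp add: card_Pow)
    also have "(2::nat) ^ card W \<le> 2 ^ b" using W by simp
    also have "card (clique_sets k H') + 2 ^ b \<le> 2 ^ b * Suc (card (lower_shadow k H'))" using IH by simp
    also have "\<dots> \<le> 2 ^ b * card (lower_shadow k H)" using sh by (rule mult_le_mono2)
    finally show ?thesis by simp
  qed
qed

section \<open>Embedding into full families\<close>

lemma full_family_avoid:
  assumes full: "full_family b H" and fin: "\<And>A. A \<in> H \<Longrightarrow> finite A"
    and W: "finite W" "card W \<le> b"
  shows "A \<in> H \<Longrightarrow> T \<subseteq> A \<Longrightarrow> \<exists>A'\<in>H. T \<subseteq> A' \<and> (A' - T) \<inter> W = {}"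
proof (induction "card ((A - T) \<inter> W)" arbitrary: A rule: less_induct)
  case less
  show ?case
  proof (cases "(A - T) \<inter> W = {}")
    case True
    then show ?thesis using less.prems by blast
  next
    case False
    then obtain x where x: "x \<in> A" "x \<notin> T" "x \<in> W" by blast
    \<comment> \<open>Exchanging \<open>x\<close> for a vertex off \<open>W\<close> keeps
      \<open>T\<close> and lowers the number of vertices of \<open>A - T\<close> in
      \<open>W\<close>.\<close>
    obtain z where z: "z \<notin> W" "insert z (A - {x}) \<in> H"
      using full less.prems(1) x(1) W unfolding full_family_def by blast
    let ?A = "insert z (A - {x})"
    have "(?A - T) \<inter> W \<subseteq> (A - T) \<inter> W - {x}" using x(3) z(1) by auto
    also have "\<dots> \<subset> (A - T) \<inter> W" using x by auto
    finally have "card ((?A - T) \<inter> W) < card ((A - T) \<inter> W)"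
      using fin[OF less.prems(1)] by (intro psubset_card_mono) auto
    moreover have "T \<subseteq> ?A" using less.prems(2) x(2) by blast
    ultimately show ?thesis using less.hyps z(2) by blast
  qed
qed

text \<open>The member above the embedded part of \<open>e\<close> is first moved so that its other
  vertices avoid the image of \<open>U\<close>; they are then as many as the new vertices of
  \<open>e\<close> and can receive them.\<close>

lemma full_family_extend:
  assumes full: "full_family b H" and H: "\<And>A. A \<in> H \<Longrightarrow> finite A \<and> card A = k"
    and U: "finite U" "card U \<le> b" and inj: "inj_on \<phi> U" and e: "finite e" "card e = k"
    and A: "A \<in> H" "\<phi> ` (e \<inter> U) \<subseteq> A"
  shows "\<exists>\<phi>'. inj_on \<phi>' (U \<union> e) \<and> (\<forall>x\<in>U. \<phi>' x = \<phi> x) \<and> \<phi>' ` e \<in> H"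
proof -
  let ?T = "\<phi> ` (e \<inter> U)"
  have "card (\<phi> ` U) \<le> b" using U card_image_le[OF U(1), of \<phi>] by simp
  then obtain A' where A': "A' \<in> H" "?T \<subseteq> A'" "(A' - ?T) \<inter> \<phi> ` U = {}"
    using full_family_avoid[OF full, of "\<phi> ` U" A ?T] H U A by blast
  have fA: "finite A'" "card A' = k" using H[OF A'(1)] by auto
  have "card ?T = card (e \<inter> U)" by (rule card_image) (use inj in \<open>auto intro: inj_on_subset\<close>)
  then have "card (A' - ?T) = card (e - U)"
    using A'(2) fA e finite_subset[OF A'(2)] by (simp add: card_Diff_subset card_Diff_subset_Int)
  then obtain g where g: "bij_betw g (e - U) (A' - ?T)"
    using finite_same_card_bij[of "e - U" "A' - ?T"] e(1) fA(1) by auto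
  define \<phi>' where "\<phi>' x = (if x \<in> U then \<phi> x else g x)" for x
  have gimg: "g ` (e - U) = A' - ?T" using g by (simp add: bij_betw_def)
  have "inj_on \<phi>' (U \<union> (e - U))"
  proof (rule inj_on_Un[THEN iffD2], intro conjI)
    show "inj_on \<phi>' U" using inj by (simp add: \<phi>'_def inj_on_def)
    show "inj_on \<phi>' (e - U)" using bij_betw_imp_inj_on[OF g] by (simp add: \<phi>'_def inj_on_def)
    have "\<phi>' ` (e - U - U) \<subseteq> g ` (e - U)" "\<phi>' ` (U - (e - U)) \<subseteq> \<phi> ` U" by (auto simp: \<phi>'_def)
    from Int_mono[OF this] have "\<phi>' ` (e - U - U) \<inter> \<phi>' ` (U - (e - U)) \<subseteq> {}"
      unfolding gimg A'(3) .
    then show "\<phi>' ` (U - (e - U)) \<inter> \<phi>' ` (e - U - U) = {}"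
      by (simp only: Int_commute subset_empty)
  qed
  then have "inj_on \<phi>' (U \<union> e)" by simp
  moreover have "\<phi>' ` e = A'"
  proof -
    have "\<phi>' ` e = \<phi>' ` (e \<inter> U) \<union> \<phi>' ` (e - U)" by blast
    also have "\<phi>' ` (e \<inter> U) = ?T" by (auto simp: \<phi>'_def)
    also have "\<phi>' ` (e - U) = g ` (e - U)" by (auto simp: \<phi>'_def)
    finally show ?thesis using gimg A'(2) by auto
  qed
  moreover have "\<forall>x\<in>U. \<phi>' x = \<phi> x" by (simp add: \<phi>'_def)
  ultimately show ?thesis using A'(1) by blast
qed

text \<open>\<open>U0\<close> holds vertices placed in advance. A new edge may meet the earlier
  vertices inside a single earlier edge, as in edge-degenerate hypergraphs, or inside
  \<open>U0\<close> with an image already below a member, as in linear cycles.\<close>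

lemma full_family_extend_list:
  assumes full: "full_family b H" and H: "\<And>A. A \<in> H \<Longrightarrow> finite A \<and> card A = k"
    and fin: "finite U0" and b: "card (U0 \<union> \<Union> (set es)) \<le> b"
    and inj: "inj_on \<phi>0 U0" and es: "\<And>e. e \<in> set es \<Longrightarrow> finite e \<and> card e = k"
    and attach: "\<And>i. i < length es \<Longrightarrow>
      (\<exists>j<i. es ! i \<inter> (U0 \<union> (\<Union>r<i. es ! r)) \<subseteq> es ! j) \<or>
      (es ! i \<inter> (U0 \<union> (\<Union>r<i. es ! r)) \<subseteq> U0 \<and> (\<exists>A\<in>H. \<phi>0 ` (es ! i \<inter> (U0 \<union> (\<Union>r<i. es ! r))) \<subseteq> A))"
  shows "\<exists>\<phi>. inj_on \<phi> (U0 \<union> \<Union> (set es)) \<and> (\<forall>e\<in>set es. \<phi> ` e \<in> H)"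
proof -
  have finA: "finite (U0 \<union> \<Union> (set es))" using fin es by blast
  have "m \<le> length es \<Longrightarrow> \<exists>\<phi>. inj_on \<phi> (U0 \<union> (\<Union>r<m. es ! r)) \<and> (\<forall>x\<in>U0. \<phi> x = \<phi>0 x)
      \<and> (\<forall>r<m. \<phi> ` (es ! r) \<in> H)" for m
  proof (induction m)
    case 0
    then show ?case using inj by auto
  next
    case (Suc m)
    then obtain \<phi> where \<phi>: "inj_on \<phi> (U0 \<union> (\<Union>r<m. es ! r))" "\<forall>x\<in>U0. \<phi> x = \<phi>0 x"
      "\<forall>r<m. \<phi> ` (es ! r) \<in> H" by auto
    let ?U = "U0 \<union> (\<Union>r<m. es ! r)"
    have m: "m < length es" using Suc.prems by simp
    have em: "finite (es ! m)" "card (es ! m) = k" using es[of "es ! m"] m by auto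
    have sub: "?U \<subseteq> U0 \<union> \<Union> (set es)" using m by force
    have U: "finite ?U" "card ?U \<le> b"
      using finite_subset[OF sub finA] card_mono[OF finA sub] b by auto
    obtain A where A: "A \<in> H" "\<phi> ` (es ! m \<inter> ?U) \<subseteq> A"
    proof -
      from attach[OF m] consider j where "j < m" "es ! m \<inter> ?U \<subseteq> es ! j"
        | A where "es ! m \<inter> ?U \<subseteq> U0" "A \<in> H" "\<phi>0 ` (es ! m \<inter> ?U) \<subseteq> A" by blast
      then show thesis
      proof cases
        case 1
        then show thesis using that[of "\<phi> ` (es ! j)"] \<phi>(3) by blast
      next
        case 2
        then have "\<phi> ` (es ! m \<inter> ?U) = \<phi>0 ` (es ! m \<inter> ?U)"
          using \<phi>(2) by (intro image_cong) auto
        then show thesis using that[of A] 2 by simp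
      qed
    qed
    obtain \<phi>' where \<phi>': "inj_on \<phi>' (?U \<union> es ! m)" "\<forall>x\<in>?U. \<phi>' x = \<phi> x" "\<phi>' ` (es ! m) \<in> H"
      using full_family_extend[OF full H U \<phi>(1) em A] by blast
    have "?U \<union> es ! m = U0 \<union> (\<Union>r<Suc m. es ! r)" by (auto simp: lessThan_Suc)
    moreover have "\<phi>' ` (es ! r) \<in> H" if "r < Suc m" for r
    proof (cases "r = m")
      case False
      then have "r < m" using that by simp
      then have "\<phi>' ` (es ! r) = \<phi> ` (es ! r)" using \<phi>'(2) by (intro image_cong) auto
      then show ?thesis using \<phi>(3) \<open>r < m\<close> by simp
    qed (use \<phi>'(3) in simp)
    moreover have "\<forall>x\<in>U0. \<phi>' x = \<phi>0 x" using \<phi>'(2) \<phi>(2) by auto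
    ultimately show ?case using \<phi>'(1) by metis
  qed
  from this[of "length es"] obtain \<phi> where \<phi>: "inj_on \<phi> (U0 \<union> (\<Union>r<length es. es ! r))"
    "\<forall>r<length es. \<phi> ` (es ! r) \<in> H" by auto
  have "(\<Union>r<length es. es ! r) = \<Union> (set es)"
    by (auto simp: set_conv_nth)
  then show ?thesis using \<phi> by (metis in_set_conv_nth)
qed

lemma edge_degenerate_embedding:
  assumes full: "full_family b H" "H \<noteq> {}" and H: "\<And>A. A \<in> H \<Longrightarrow> finite A \<and> card A = k"
    and K: "edge_degenerate K" and E: "\<And>e. e \<in> edges K \<Longrightarrow> finite e \<and> card e = k"
    and b: "card (\<Union> (edges K)) \<le> b"
  shows "\<exists>\<phi>. inj_on \<phi> (\<Union> (edges K)) \<and> (\<forall>e\<in>edges K. \<phi> ` e \<in> H)"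
proof -
  obtain es where es: "set es = edges K"
    "\<forall>i\<in>{1..<length es}. \<exists>j<i. es ! i \<inter> (\<Union>r<i. es ! r) \<subseteq> es ! j"
    using K unfolding edge_degenerate_def by blast
  have "\<exists>\<phi>. inj_on \<phi> ({} \<union> \<Union> (set es)) \<and> (\<forall>e\<in>set es. \<phi> ` e \<in> H)"
  proof (rule full_family_extend_list[OF full(1) H])
    \<comment> \<open>No vertex is placed in advance, so any map will do; the first edge uses the
      second alternative with an arbitrary member of \<open>H\<close>.\<close>
    show "inj_on undefined {}" by simp
    fix i assume i: "i < length es"
    show "(\<exists>j<i. es ! i \<inter> ({} \<union> (\<Union>r<i. es ! r)) \<subseteq> es ! j) \<or>
      (es ! i \<inter> ({} \<union> (\<Union>r<i. es ! r)) \<subseteq> {} \<and> (\<exists>A\<in>H. undefined ` (es ! i \<inter> ({} \<union> (\<Union>r<i. es ! r))) \<subseteq> A))"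
    proof (cases "i = 0")
      case True
      then show ?thesis using full(2) by auto
    next
      case False
      then show ?thesis using es(2) i by simp
    qed
  qed (use es E b in auto)
  then show ?thesis using es(1) by simp
qed

text \<open>The 2-shadow of a full family contains cycles of all lengths: a triangle inside one member, then
  replace the closing edge by a path of length 2 through a new vertex.\<close>
lemma full_family_shadow_cycle:
  assumes full: "full_family b H" "H \<noteq> {}" and H: "\<And>A. A \<in> H \<Longrightarrow> finite A \<and> card A = k"
    and k: "k \<ge> 3" and s: "s \<ge> 3"
  shows "s \<le> b \<Longrightarrow> \<exists>v :: nat \<Rightarrow> 'a. inj_on v {..<s} \<and> (\<forall>i<s. \<exists>A\<in>H. {v i, v (Suc i mod s)} \<subseteq> A)"
  using s
proof (induction s rule: nat_induct_at_least)
  case base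
  obtain A where A: "A \<in> H" using full(2) by blast
  then obtain X where "X \<subseteq> A" "card X = 3" using H k by (metis obtain_subset_with_card_n)
  then obtain x y z where xyz: "x \<in> A" "y \<in> A" "z \<in> A" "x \<noteq> y" "y \<noteq> z" "x \<noteq> z"
    by (auto simp: card_3_iff)
  define v where "v i = (if i = 0 then x else if i = 1 then y else z)" for i :: nat
  have "inj_on v {..<3}" using xyz by (auto simp: v_def inj_on_def split: if_splits)
  moreover have "{v i, v (Suc i mod 3)} \<subseteq> A" for i using xyz by (auto simp: v_def)
  ultimately show ?case using A by blast
next
  case (Suc s)
  then obtain v where v: "inj_on v {..<s}" "\<And>i. i < s \<Longrightarrow> \<exists>A\<in>H. {v i, v (Suc i mod s)} \<subseteq> A"
    by auto
  have s3: "s \<ge> 3" by (rule Suc.hyps)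
  then have "Suc (s - 1) mod s = 0" by simp
  then obtain A where A: "A \<in> H" "{v (s - 1), v 0} \<subseteq> A" using v(2)[of "s - 1"] s3 by auto
  have "card (v ` {..<s}) \<le> b" using Suc.prems card_image_le[of "{..<s}" v] by simp
  then obtain A' where A': "A' \<in> H" "{v (s - 1), v 0} \<subseteq> A'" "(A' - {v (s - 1), v 0}) \<inter> v ` {..<s} = {}"
    using full_family_avoid[OF full(1), of "v ` {..<s}" A "{v (s - 1), v 0}"] H A by blast
  \<comment> \<open>As \<open>k \<ge> 3\<close>, the pair does not fill \<open>A'\<close>, which
    therefore has a new vertex \<open>z\<close>; it receives the index \<open>s\<close>.\<close>
  have "card {v (s - 1), v 0} \<le> 2" by (simp add: card_insert_if)
  then have "\<not> A' \<subseteq> {v (s - 1), v 0}"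
    using card_mono[of "{v (s - 1), v 0}" A'] H[OF A'(1)] k by auto
  then obtain z where z: "z \<in> A'" "z \<notin> v ` {..<s}" using A'(3) by blast
  define w where "w = v(s := z)"
  have "inj_on w {..<Suc s}"
    using v(1) z(2) by (auto simp: w_def inj_on_def lessThan_Suc)
  moreover have "\<exists>A\<in>H. {w i, w (Suc i mod Suc s)} \<subseteq> A" if i: "i < Suc s" for i
  proof -
    consider "i < s - 1" | "i = s - 1" | "i = s" using i by linarith
    then show ?thesis
    proof cases
      case 1
      then have "Suc i mod s = Suc i" "Suc i mod Suc s = Suc i" "i \<noteq> s" "Suc i \<noteq> s" by auto
      then show ?thesis using v(2)[of i] 1 by (simp add: w_def)
    next
      case 2
      then have "Suc i mod Suc s = s" "i \<noteq> s" using s3 by auto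
      then show ?thesis using A'(1,2) z(1) 2 by (auto simp: w_def)
    next
      case 3
      then show ?thesis using A'(1,2) z(1) s3 by (auto simp: w_def)
    qed
  qed
  ultimately show ?case by blast
qed

text \<open>In every order the last edge meets the others in two joints that no single earlier edge
  contains, so the edges cannot just be attached in turn. The joints are placed first, along a cycle
  of the 2-shadow; each edge then meets the vertices already placed in its two joints only.\<close>

lemma linear_cycle_embedding:
  fixes H :: "'b set set" and K :: "'a hypergraph"
  assumes full: "full_family b H" "H \<noteq> {}" and H: "\<And>A. A \<in> H \<Longrightarrow> finite A \<and> card A = k"
    and k: "k \<ge> 3" and K: "linear_cycle k K" and b: "card (verts K) \<le> b"
  shows "\<exists>\<phi>. inj_on \<phi> (\<Union> (edges K)) \<and> (\<forall>e\<in>edges K. \<phi> ` e \<in> H)"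
proof -
  obtain es where dist: "distinct es" and es: "set es = edges K" and s3: "3 \<le> length es"
    and inter': "\<forall>i<length es. \<forall>j<length es. i \<noteq> j \<longrightarrow>
           (if j = Suc i mod length es \<or> i = Suc j mod length es
            then card (es ! i \<inter> es ! j) = 1
            else es ! i \<inter> es ! j = {})"
    and deg': "\<forall>v\<in>verts K. card {e \<in> edges K. v \<in> e} \<le> 2"
    using K unfolding linear_cycle_def by (elim conjE exE)
  note inter = inter'[rule_format] and deg = deg'[rule_format]
  have VK: "verts K = \<Union> (edges K)" and unif: "uniform_hypergraph k K"
    using K unfolding linear_cycle_def by auto
  have finV: "finite (verts K)" using unif by (simp add: uniform_hypergraph_def is_hypergraph_def)
  have E: "finite e \<and> card e = k" if "e \<in> edges K" for e
    using unif that finV finite_subset[of e "verts K"]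
    by (auto simp: uniform_hypergraph_def is_hypergraph_def)
  define s where "s = length es"
  note s3' = s3[folded s_def]
  have in_es: "es ! i \<in> edges K" if "i < s" for i
    using that es nth_mem[of i es] by (simp add: s_def)
  have next_less: "Suc i mod s < s" for i using s3' by simp
  have next_ne: "i \<noteq> Suc i mod s" if "i < s" for i
    using that s3' by (auto simp: mod_Suc)
  have next2_ne: "Suc (Suc i mod s) mod s \<noteq> i" if "i < s" for i
    using that s3' by (auto simp: mod_Suc)
  have "\<exists>x. es ! i \<inter> es ! (Suc i mod s) = {x}" if i: "i < s" for i
    using inter[of i "Suc i mod s"] i next_less next_ne[OF i] unfolding s_def
    by (simp add: card_1_singleton_iff)
  \<comment> \<open>\<open>p i\<close> is the joint of the edges \<open>i\<close> and
    \<open>i + 1\<close>, with indices modulo \<open>s\<close>.\<close>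
  then obtain p where p: "\<And>i. i < s \<Longrightarrow> es ! i \<inter> es ! (Suc i mod s) = {p i}" by metis
  \<comment> \<open>No vertex lies in three edges; for length 3 this is what keeps the joints
    distinct.\<close>
  have deg2: "c = a \<or> c = a'" if "a < s" "a' < s" "c < s" "a \<noteq> a'" "x \<in> es ! a" "x \<in> es ! a'" "x \<in> es ! c" for a a' c x
  proof (rule ccontr)
    assume "\<not> (c = a \<or> c = a')"
    then have "card {es ! a, es ! a', es ! c} = 3"
      using that dist by (auto simp: nth_eq_iff_index_eq s_def)
    moreover have "{es ! a, es ! a', es ! c} \<subseteq> {e \<in> edges K. x \<in> e}"
      using that(5,6,7) in_es[OF that(1)] in_es[OF that(2)] in_es[OF that(3)] by simp
    moreover have "finite {e \<in> edges K. x \<in> e}" unfolding es[symmetric] by simp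
    ultimately have "3 \<le> card {e \<in> edges K. x \<in> e}" by (metis card_mono)
    moreover have "x \<in> verts K" using that(5) in_es[OF that(1)] VK by blast
    ultimately show False using deg[of x] by simp
  qed
  have p_in: "j = i \<or> j = Suc i mod s" if "i < s" "j < s" "p i \<in> es ! j" for i j
    using deg2[of i "Suc i mod s" j "p i"] that next_less next_ne p by blast
  have p_inj: "inj_on p {..<s}"
  proof (rule inj_onI)
    fix i j assume ij: "i \<in> {..<s}" "j \<in> {..<s}" "p i = p j"
    then have "p i \<in> es ! j" "p i \<in> es ! (Suc j mod s)" using p[of j] by auto
    then have "j = i \<or> j = Suc i mod s" "Suc j mod s = i \<or> Suc j mod s = Suc i mod s"
      using p_in[of i j] p_in[of i "Suc j mod s"] ij next_less by auto
    then show "i = j" using next2_ne[of i] next_ne[of j] ij by auto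
  qed
  define U0 where "U0 = p ` {..<s}"
  have U0V: "U0 \<subseteq> \<Union> (set es)"
  proof
    fix x assume "x \<in> U0"
    then obtain i where "i < s" "x = p i" by (auto simp: U0_def)
    then have "x \<in> es ! i" "es ! i \<in> set es" using p[of i] by (auto simp: s_def)
    then show "x \<in> \<Union> (set es)" by blast
  qed
  have "s = card U0" unfolding U0_def using p_inj by (simp add: card_image)
  also have "\<dots> \<le> card (verts K)" using U0V VK es finV by (intro card_mono) auto
  finally have "s \<le> b" using b by simp
  then obtain v :: "nat \<Rightarrow> 'b" where v: "inj_on v {..<s}" "\<forall>i<s. \<exists>A\<in>H. {v i, v (Suc i mod s)} \<subseteq> A"
    using full_family_shadow_cycle[OF full H k s3'] by blast
  define \<phi>0 where "\<phi>0 = v \<circ> the_inv_into {..<s} p"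
  have \<phi>0: "\<phi>0 (p i) = v i" if "i < s" for i
    using that p_inj by (simp add: \<phi>0_def the_inv_into_f_f)
  have "inj_on \<phi>0 U0"
  proof (rule inj_onI)
    fix x y assume "x \<in> U0" "y \<in> U0" "\<phi>0 x = \<phi>0 y"
    then obtain i j where "i < s" "x = p i" "j < s" "y = p j" "v i = v j"
      unfolding U0_def using \<phi>0 by auto
    then show "x = y" using v(1) by (auto simp: inj_on_def)
  qed
  have attach: "es ! i \<inter> (U0 \<union> (\<Union>r<i. es ! r)) \<subseteq> U0 \<and> (\<exists>A\<in>H. \<phi>0 ` (es ! i \<inter> (U0 \<union> (\<Union>r<i. es ! r))) \<subseteq> A)"
    if i: "i < s" for i
  proof -
    \<comment> \<open>The cyclic predecessor of \<open>i\<close>: the joints of edge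
      \<open>i\<close> are \<open>p q\<close> and \<open>p i\<close>.\<close>
    define q where "q = (if i = 0 then s - 1 else i - 1)"
    have q: "q < s" "Suc q mod s = i" using i by (auto simp: q_def)
    have q_unique: "j = q" if "j < s" "Suc j mod s = i" for j
      using that q by (auto simp: mod_Suc split: if_splits)
    have sub: "es ! i \<inter> (U0 \<union> (\<Union>r<i. es ! r)) \<subseteq> {p q, p i}"
    proof
      fix x assume x: "x \<in> es ! i \<inter> (U0 \<union> (\<Union>r<i. es ! r))"
      then consider j where "j < s" "x = p j" | r where "r < i" "x \<in> es ! r" by (auto simp: U0_def)
      then show "x \<in> {p q, p i}"
      proof cases
        case 1
        then show ?thesis using p_in[of j i] x i q_unique[of j] by auto
      next
        case 2
        then have r: "r < s" "r \<noteq> i" using i by auto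
        have "i = Suc r mod s \<or> r = Suc i mod s"
          using inter[of r i] r i x 2(2) unfolding s_def by (auto split: if_splits)
        then show ?thesis
        proof
          assume a: "i = Suc r mod s"
          then have "x = p r" using p[OF r(1)] x 2(2) by auto
          then show ?thesis using q_unique[OF r(1)] a by simp
        next
          assume "r = Suc i mod s"
          then have "x = p i" using p[OF i] x 2(2) by auto
          then show ?thesis by simp
        qed
      qed
    qed
    obtain A where A: "A \<in> H" "{v q, v i} \<subseteq> A" using v(2) q by metis
    have "{p q, p i} \<subseteq> U0" using q i by (auto simp: U0_def)
    moreover have "\<phi>0 ` (es ! i \<inter> (U0 \<union> (\<Union>r<i. es ! r))) \<subseteq> \<phi>0 ` {p q, p i}"
      using sub by (rule image_mono)
    moreover have "\<phi>0 ` {p q, p i} \<subseteq> A" using A(2) \<phi>0[OF q(1)] \<phi>0[OF i] by simp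
    ultimately have "\<phi>0 ` (es ! i \<inter> (U0 \<union> (\<Union>r<i. es ! r))) \<subseteq> A" "{p q, p i} \<subseteq> U0" by (simp_all only: subset_trans)
    then show ?thesis using subset_trans[OF sub] A(1) by blast
  qed
  have "\<exists>\<phi>. inj_on \<phi> (U0 \<union> \<Union> (set es)) \<and> (\<forall>e\<in>set es. \<phi> ` e \<in> H)"
  proof (rule full_family_extend_list[OF full(1) H _ _ \<open>inj_on \<phi>0 U0\<close>])
    show "finite U0" by (simp add: U0_def)
    show "card (U0 \<union> \<Union> (set es)) \<le> b" using U0V VK es b by (simp add: Un_absorb1)
  qed (use E es attach in \<open>auto simp: s_def\<close>)
  then show ?thesis using U0V es by (simp add: Un_absorb1)
qed

section \<open>Order of magnitude for pure complexes\<close>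

lemma ex_complex_upper_bound:
  fixes F :: "'a hypergraph"
  assumes k: "k \<ge> 2" and F: "simplicial_complex F" "complex_dim F = int k - 1"
    and pure: "maximal_edges F = edges (uniform_part F k)"
    and deg: "edge_degenerate (uniform_part F k) \<or> (k \<ge> 3 \<and> linear_cycle k (uniform_part F k))"
  shows "ex_complex n F \<le> 2 ^ card (verts F) * (n choose (k - 1)) + binom_sum n k"
proof -
  \<comment> \<open>The number of vertices of \<open>F\<close> is all the room that an embedding
    needs, so no nonempty family of \<open>k\<close>-edges of an \<open>F\<close>-free host is full
    for this value.\<close>
  let ?b = "card (verts F)" and ?K = "uniform_part F k"
  obtain G0 :: "nat hypergraph" where G0: "simplicial_complex G0" "card (verts G0) = n"
    "\<And>e. e \<in> edges G0 \<Longrightarrow> card e < k"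
    using exists_complex_without_k_edge[OF k] by metis
  have nG0: "\<not> embeds F G0" using not_embeds_if_no_k_edge[OF F] G0(3) by (metis nat_neq_iff)
  obtain G :: "nat hypergraph" where G: "simplicial_complex G" "card (verts G) = n" "\<not> embeds F G"
    "card (edges G) = ex_complex n F"
    by (rule ex_complex_attained[OF G0(1,2) nG0])
  note Gs = simplicial_complexD[OF G(1)]
  define H where "H = {A \<in> edges G. card A = k}"
  have HA: "finite A \<and> card A = k" if "A \<in> H" for A using that Gs(6) by (auto simp: H_def)
  have finH: "finite H" using Gs(2) by (simp add: H_def)
  have V: "\<Union> (edges ?K) = verts F" using Union_maximal_edges[OF F(1)] pure by simp
  have EK: "finite e \<and> card e = k" if "e \<in> edges ?K" for e
    using that simplicial_complexD(6)[OF F(1)] by (auto simp: uniform_part_def)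
  have not_full: "\<not> full_family ?b H'" if H': "H' \<subseteq> H" "H' \<noteq> {}" for H'
  proof
    assume full: "full_family ?b H'"
    have HA': "finite A \<and> card A = k" if "A \<in> H'" for A using that HA H'(1) by blast
    have "\<exists>\<phi>. inj_on \<phi> (\<Union> (edges ?K)) \<and> (\<forall>e\<in>edges ?K. \<phi> ` e \<in> H')"
      using deg
    proof
      assume "edge_degenerate ?K"
      then show ?thesis using V by (intro edge_degenerate_embedding[OF full H'(2) HA' _ EK]) auto
    next
      assume "k \<ge> 3 \<and> linear_cycle k ?K"
      then show ?thesis by (intro linear_cycle_embedding[OF full H'(2) HA']) (auto simp: uniform_part_def)
    qed
    then obtain \<phi> where \<phi>: "inj_on \<phi> (\<Union> (maximal_edges F))" "\<And>e. e \<in> maximal_edges F \<Longrightarrow> \<phi> ` e \<in> H'"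
      unfolding pure by blast
    then have "embeds F G" using H'(1) by (intro embedsI_maximal[OF F(1) G(1), of \<phi>]) (auto simp: H_def)
    then show False using G(3) by contradiction
  qed
  have "{T \<in> edges G. k \<le> card T} \<subseteq> clique_sets k H"
    using Gs(6,7) by (auto simp: clique_sets_def H_def)
  moreover have "finite (clique_sets k H)"
    using clique_sets_subset_Pow[of k H] k finH HA by (auto intro: finite_subset)
  ultimately have "card {T \<in> edges G. k \<le> card T} \<le> card (clique_sets k H)" by (intro card_mono)
  also have "\<dots> \<le> 2 ^ ?b * card (lower_shadow k H)"
    using k finH HA not_full by (intro card_clique_sets_le) auto
  also have "card (lower_shadow k H) \<le> card {S. S \<subseteq> verts G \<and> card S = k - 1}"
    using Gs(1,5) by (intro card_mono) (auto simp: lower_shadow_def H_def intro: finite_subset[of _ "Pow (verts G)"])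
  also have "\<dots> = n choose (k - 1)" using Gs(1) G(2) by (simp add: n_subsets)
  finally have "card {T \<in> edges G. k \<le> card T} \<le> 2 ^ ?b * (n choose (k - 1))" by simp
  then show ?thesis
    using card_edges_split[OF G(1), of k] card_small_edges_le[OF G(1), of k] unfolding G(2,4) by linarith
qed

lemma ex_complex_lower_bound:
  assumes k: "k \<ge> 2" and F: "simplicial_complex F" "complex_dim F = int k - 1"
  shows "binom_sum n k \<le> ex_complex n F"
proof -
  obtain G :: "nat hypergraph" where G: "simplicial_complex G" "card (verts G) = n"
    "\<And>e. e \<in> edges G \<Longrightarrow> card e < k" "card (edges G) = binom_sum n k"
    using exists_complex_without_k_edge[OF k] by metis
  have "\<not> embeds F G" using not_embeds_if_no_k_edge[OF F] G(3) by (metis nat_neq_iff)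
  then show ?thesis using ex_complex_ge[OF G(1,2)] G(4) by simp
qed

text \<open>\<open>binom_sum n k\<close> is \<open>n choose (k - 1)\<close> plus lower order terms,
  so both bounds are of the order of \<open>n choose (k - 1)\<close>.\<close>

lemma ex_complex_bigtheta:
  fixes F :: "'a hypergraph"
  assumes k: "k \<ge> 2" and F: "simplicial_complex F" "complex_dim F = int k - 1"
    and pure: "maximal_edges F = edges (uniform_part F k)"
    and deg: "edge_degenerate (uniform_part F k) \<or> (k \<ge> 3 \<and> linear_cycle k (uniform_part F k))"
  shows "(\<lambda>n. real (ex_complex n F)) \<in> \<Theta>(\<lambda>n. real n ^ (k - 1))"
proof -
  define p where "p = k - 1"
  define c where "c = (2::nat) ^ card (verts F) + 1"
  have bs: "binom_sum n k = (n choose p) + binom_sum n p" for n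
    using k by (cases k) (auto simp: binom_sum_def p_def)
  have up: "real (ex_complex n F) \<le> real c * real (n choose p) + real (binom_sum n p)" for n
    using ex_complex_upper_bound[OF assms, of n] bs[of n]
    by (simp add: c_def p_def algebra_simps flip: of_nat_mult of_nat_add of_nat_power)
  have low: "real (n choose p) \<le> real (ex_complex n F)" for n
    using ex_complex_lower_bound[OF k F, of n] bs[of n] by simp
  have lim: "(\<lambda>n. real (n choose p) / real n ^ p) \<longlonglongrightarrow> 1 / fact p"
    using binomial_tendsto[of 0 p] by simp
  have "(\<lambda>n. real c * (real (n choose p) / real n ^ p) + real (binom_sum n p) / real n ^ p)
      \<longlonglongrightarrow> real c * (1 / fact p) + 0"
    by (intro tendsto_add tendsto_mult tendsto_const lim binom_sum_tendsto)
  from order_tendstoD(2)[OF this, of "real c * (1 / fact p) + 1"]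
  have ev_up: "\<forall>\<^sub>F n in sequentially. real c * (real (n choose p) / real n ^ p) + real (binom_sum n p) / real n ^ p
      < real c * (1 / fact p) + 1" by simp
  \<comment> \<open>Half of the limit is a positive lower bound from some point on.\<close>
  have ev_low: "\<forall>\<^sub>F n in sequentially. 1 / (2 * fact p) < real (n choose p) / real n ^ p"
    by (rule order_tendstoD(1)[OF lim]) (simp add: divide_simps)
  have "(\<lambda>n. real (ex_complex n F)) \<in> O(\<lambda>n. real n ^ p)"
  proof (rule bigoI)
    show "\<forall>\<^sub>F n in sequentially. norm (real (ex_complex n F)) \<le> (real c * (1 / fact p) + 1) * norm (real n ^ p)"
      using ev_up eventually_gt_at_top[of 0]
    proof eventually_elim
      case (elim n)
      have "real (ex_complex n F) \<le> (real c * (real (n choose p) / real n ^ p) + real (binom_sum n p) / real n ^ p) * real n ^ p"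
        using up[of n] elim(2) by (simp add: distrib_right)
      also have "\<dots> \<le> (real c * (1 / fact p) + 1) * real n ^ p"
        using elim(1) by (intro mult_right_mono) auto
      finally show ?case by simp
    qed
  qed
  moreover have "(\<lambda>n. real (ex_complex n F)) \<in> \<Omega>(\<lambda>n. real n ^ p)"
  proof (rule landau_omega.bigI)
    show "1 / (2 * fact p) > (0::real)" by simp
    show "\<forall>\<^sub>F n in sequentially. 1 / (2 * fact p) * norm (real n ^ p) \<le> norm (real (ex_complex n F))"
      using ev_low eventually_gt_at_top[of 0]
    proof eventually_elim
      case (elim n)
      have "1 / (2 * fact p) * real n ^ p \<le> real (n choose p) / real n ^ p * real n ^ p"
        using elim(1) by (intro mult_right_mono) auto
      also have "\<dots> = real (n choose p)" using elim(2) by simp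
      also have "\<dots> \<le> real (ex_complex n F)" by (rule low)
      finally show ?case by simp
    qed
  qed
  ultimately show ?thesis unfolding p_def by (rule bigthetaI)
qed

theorem theorem1p3:
  fixes k :: nat and F :: "'a hypergraph"
  assumes "k \<ge> 2" and "simplicial_complex F" and "complex_dim F = int k - 1"
  shows
    "(maximal_edges F = edges (uniform_part F k) \<or>
      pairwise disjnt (maximal_edges F) \<or>
      card (maximal_edges F) \<le> 2 \<or>
      (k \<ge> 3 \<and> isomorphic (config_iv k) (Hypergraph (verts F) (maximal_edges F)))
        \<longrightarrow> trivial_complex k F) \<and>
     (maximal_edges F = edges (uniform_part F k) \<and>
      (edge_degenerate (uniform_part F k) \<or> (k \<ge> 3 \<and> linear_cycle k (uniform_part F k)))
        \<longrightarrow> (\<lambda>n. real (ex_complex n F)) \<in> \<Theta>(\<lambda>n. real n ^ (k - 1))) \<and>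
     (pairwise disjnt (maximal_edges F)
        \<longrightarrow> (let t = card (edges (uniform_part F k)) in
             \<forall>\<^sub>F n in sequentially.
               ex_complex n F =
                 (\<Sum>r=1..t-1. \<Sum>i=1..r.
                    (if i \<le> k then ((t - 1) choose r) * ((n - t + 1) choose (k - i)) else 0))
                 + (\<Sum>r=0..k-1. n choose r)))"
proof (intro conjI impI)
  assume "maximal_edges F = edges (uniform_part F k) \<or> pairwise disjnt (maximal_edges F) \<or>
    card (maximal_edges F) \<le> 2 \<or>
    (k \<ge> 3 \<and> isomorphic (config_iv k) (Hypergraph (verts F) (maximal_edges F)))"
  then show "trivial_complex k F"
    using trivial_if_pure[OF assms] trivial_if_disjoint[OF assms]
      trivial_if_two_maximal_edges[OF assms] trivial_if_config_iv[OF assms(2,3)] by blast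
next
  assume "maximal_edges F = edges (uniform_part F k) \<and>
    (edge_degenerate (uniform_part F k) \<or> (k \<ge> 3 \<and> linear_cycle k (uniform_part F k)))"
  then show "(\<lambda>n. real (ex_complex n F)) \<in> \<Theta>(\<lambda>n. real n ^ (k - 1))"
    using ex_complex_bigtheta[OF assms] by blast
next
  assume "pairwise disjnt (maximal_edges F)"
  from ex_complex_disjoint_maximal_edges[OF assms this]
  show "let t = card (edges (uniform_part F k)) in
     \<forall>\<^sub>F n in sequentially.
       ex_complex n F =
         (\<Sum>r=1..t-1. \<Sum>i=1..r.
            (if i \<le> k then ((t - 1) choose r) * ((n - t + 1) choose (k - i)) else 0))
         + (\<Sum>r=0..k-1. n choose r)"
    unfolding Let_def .
qed

end
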